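(* Let $\Omega\subset\mathbb{R}^d$ be compact and let $\Lambda^\star:\mathcal{P}(\Omega)\times\Omega\to\mathbb{R}^{d'}$ be continuous, where $\mathcal{P}(\Omega)$ carries the weak$^*$ topology and $\Omega$ the Euclidean topology. Then for every $\varepsilon>0$ there exist $L\in\mathbb{N}$, unmasked multi-head attention parameters $\theta_1,\dots,\theta_L$ and MLPs $F_{\xi_1},\dots,F_{\xi_L}$ such that $$\forall(\mu,x)\in\mathcal{P}(\Omega)\times\Omega,\qquad \big|F_{\xi_L}\diamond\Gamma_{\theta_L}\diamond\cdots\diamond F_{\xi_1}\diamond\Gamma_{\theta_1}(\mu,x)-\Lambda^\star(\mu,x)\big|\le\varepsilon,$$ and, for every $\ell$, $d_{\mathrm{in}}(\theta_\ell)\le d+3d'$, $d_{\mathrm{head}}(\theta_\ell)=k(\theta_\ell)=1$ and $H(\theta_\ell)\le d'$.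
   Context: Unmasked attention: a parameter $\theta=(W^h,K^h,Q^h,V^h)_{h=1}^H$ with $K^h,Q^h\in\mathbb{R}^{k\times d_{\mathrm{in}}}$, $V^h\in\mathbb{R}^{d_{\mathrm{head}}\times d_{\mathrm{in}}}$, $W^h\in\mathbb{R}^{d_{\mathrm{in}}\times d_{\mathrm{head}}}$; write $d_{\mathrm{in}}(\theta),d_{\mathrm{head}}(\theta),k(\theta),H(\theta)$ for these sizes. For a compactly supported probability measure $\mu$ on $\mathbb{R}^{d_{\mathrm{in}}}$ and $x\in\mathbb{R}^{d_{\mathrm{in}}}$, $$\Gamma_\theta(\mu,x)=x+\sum_{h=1}^H W^h\int\frac{\exp(\frac{1}{\sqrt k}\langle Q^hx,K^hy\rangle)}{\int\exp(\frac{1}{\sqrt k}\langle Q^hx,K^hz\rangle)\,d\mu(z)}V^hy\,d\mu(y).$$ We write $\Gamma(\mu)$ for the map $x\mapsto\Gamma(\mu,x)$. An MLP is a map $A_K\circ\rho\circ A_{K-1}\circ\cdots\circ\rho\circ A_1$ between Euclidean spaces with affine $A_j$ and ReLU activation $\rho$ applied componentwise (affine maps are the case $K=1$); an MLP $F$ is regarded as a context-free in-context map $F(\mu,x)=F(x)$. In-context composition: $(\Gamma_2\diamond\Gamma_1)(\mu,x)=\Gamma_2(\Gamma_1(\mu)_\sharp\mu,\Gamma_1(\mu,x))$, where $\sharp$ denotes push-forward. Dimensions are compatible: $d_{\mathrm{in}}(\theta_1)=d$, $F_{\xi_\ell}:\mathbb{R}^{d_{\mathrm{in}}(\theta_\ell)}\to\mathbb{R}^{d_{\mathrm{in}}(\theta_{\ell+1})}$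 for $\ell<L$, and $F_{\xi_L}$ maps into $\mathbb{R}^{d'}$. *)

theory Defs
  imports "HOL-Analysis.Analysis" "HOL-Probability.Probability"
begin

text \<open>Vectors of R^n are represented as functions nat => real vanishing at indices >= n.
  The type nat => real carries the product topology (HOL-Analysis), which on such a
  finite-dimensional coordinate subspace is the Euclidean topology.
  Matrices are functions nat => nat => real; only entries within the stated sizes are used.\<close>

type_synonym vec = "nat \<Rightarrow> real"
type_synonym mat = "nat \<Rightarrow> nat \<Rightarrow> real"

definition in_dim :: "nat \<Rightarrow> vec set" where
  "in_dim n = {v. \<forall>i\<ge>n. v i = 0}"

definition mat_vec :: "nat \<Rightarrow> nat \<Rightarrow> mat \<Rightarrow> vec \<Rightarrow> vec" where
  "mat_vec m n A x = (\<lambda>i. if i < m then (\<Sum>j<n. A i j * x j) else 0)"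

definition inner_n :: "nat \<Rightarrow> vec \<Rightarrow> vec \<Rightarrow> real" where
  "inner_n n a b = (\<Sum>i<n. a i * b i)"

definition enorm :: "nat \<Rightarrow> vec \<Rightarrow> real" where
  "enorm n v = sqrt (\<Sum>i<n. (v i)\<^sup>2)"

text \<open>Unmasked multi-head attention parameter: sizes d_in, d_head, k and a list of heads
  (W^h, K^h, Q^h, V^h) with W^h : d_in x d_head, K^h,Q^h : k x d_in, V^h : d_head x d_in.
  H(theta) is the number of heads.\<close>

record attn =
  a_din :: nat
  a_dhead :: nat
  a_k :: nat
  a_heads :: "(mat \<times> mat \<times> mat \<times> mat) list"

definition a_H :: "attn \<Rightarrow> nat" where
  "a_H \<theta> = length (a_heads \<theta>)"

type_synonym icmap = "vec measure \<Rightarrow> vec \<Rightarrow> vec"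

definition Gamma :: "attn \<Rightarrow> icmap" where
  "Gamma \<theta> \<mu> x =
    (let d = a_din \<theta>; dh = a_dhead \<theta>; k = a_k \<theta> in
     (\<lambda>i. if i < d then
        x i + (\<Sum>(W, K, Q, V)\<leftarrow>a_heads \<theta>.
          mat_vec d dh W
            (\<lambda>j. LINT y|\<mu>.
               (exp (inner_n k (mat_vec k d Q x) (mat_vec k d K y) / sqrt (real k))
                / (LINT z|\<mu>. exp (inner_n k (mat_vec k d Q x) (mat_vec k d K z) / sqrt (real k))))
               * mat_vec dh d V y j) i)
      else 0))"

text \<open>MLPs: input dimension and a nonempty list of affine layers (A, b, output dimension);
  ReLU is applied componentwise between consecutive affine layers.\<close>

type_synonym mlp = "nat \<times> (mat \<times> vec \<times> nat) list"

definition affine :: "nat \<Rightarrow> nat \<Rightarrow> mat \<Rightarrow> vec \<Rightarrow> vec \<Rightarrow> vec" where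
  "affine n m A b x = (\<lambda>i. if i < m then (\<Sum>j<n. A i j * x j) + b i else 0)"

definition relu :: "vec \<Rightarrow> vec" where
  "relu x = (\<lambda>i. max 0 (x i))"

fun mlp_layers :: "nat \<Rightarrow> (mat \<times> vec \<times> nat) list \<Rightarrow> vec \<Rightarrow> vec" where
  "mlp_layers n [] x = x"
| "mlp_layers n [(A, b, m)] x = affine n m A b x"
| "mlp_layers n ((A, b, m) # rest) x = mlp_layers m rest (relu (affine n m A b x))"

definition mlp_eval :: "mlp \<Rightarrow> vec \<Rightarrow> vec" where
  "mlp_eval F x = mlp_layers (fst F) (snd F) x"

definition mlp_valid :: "mlp \<Rightarrow> bool" where
  "mlp_valid F \<longleftrightarrow> snd F \<noteq> []"

definition mlp_in :: "mlp \<Rightarrow> nat" where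
  "mlp_in F = fst F"

definition mlp_out :: "mlp \<Rightarrow> nat" where
  "mlp_out F = snd (snd (last (snd F)))"

definition ctx_free :: "(vec \<Rightarrow> vec) \<Rightarrow> icmap" where
  "ctx_free f = (\<lambda>\<mu> x. f x)"

definition icomp :: "icmap \<Rightarrow> icmap \<Rightarrow> icmap" where
  "icomp G2 G1 = (\<lambda>\<mu> x. G2 (distr \<mu> borel (G1 \<mu>)) (G1 \<mu> x))"

fun transformer :: "(attn \<times> mlp) list \<Rightarrow> icmap" where
  "transformer [] = (\<lambda>\<mu> x. x)"
| "transformer [(\<theta>, F)] = icomp (ctx_free (mlp_eval F)) (Gamma \<theta>)"
| "transformer ((\<theta>, F) # rest) =
     icomp (transformer rest) (icomp (ctx_free (mlp_eval F)) (Gamma \<theta>))"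

definition Prob :: "vec set \<Rightarrow> vec measure set" where
  "Prob \<Omega> = {\<mu>. prob_space \<mu> \<and> sets \<mu> = sets borel \<and> emeasure \<mu> \<Omega> = 1}"

definition weakstar :: "vec set \<Rightarrow> vec measure topology" where
  "weakstar \<Omega> = topology_generated_by
     {{\<mu> \<in> Prob \<Omega>. (LINT y:\<Omega>|\<mu>. f y) \<in> U} | f U.
        continuous_on \<Omega> (f :: vec \<Rightarrow> real) \<and> open U}"

end

theory Submission
  imports Defs
begin

text \<open>
  On the weak* compact space of pairs, the lattice form of the Stone--Weierstrass theorem
  approximates each coordinate of the target by a maximum of minima of functions that interpolate
  it at two points. It suffices to interpolate with
  \<open>a + \<langle>\<beta>, x\<rangle> + \<gamma> (r(x) + \<integral> r d\<mu>)\<close> for a ridge function \<open>r(y) = max 0 (\<langle>c, y\<rangle> + b)\<close>: the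
  integrals of all ridge functions determine the laws of all linear forms under \<open>\<mu>\<close>, hence \<open>\<mu>\<close>.

  Such a max-min expression is computed without error. The tokens carry \<open>x\<close>, the \<open>d'\<close>
  partial maxima, one partial minimum and one scratch register, which is \<open>d + d' + 2\<close>
  numbers; a head with zero query adds the mean of the scratch register to it, and minimum and
  maximum are affine up to a single ReLU. As \<open>x\<close> is never modified, the push-forwards
  lose no information.
\<close>

section \<open>Lattice Stone--Weierstrass theorem\<close>

text \<open>Lattice operations are preferred to products because ReLU networks compute them exactly,
  so the approximation theorem is the only source of error. The sum of a ridge and its mean is
  dictated by the residual connection: a head can only add to what a register already holds.\<close>

inductive_set mins :: "('a \<Rightarrow> real) set \<Rightarrow> ('a \<Rightarrow> real) set" for S where
  base: "f \<in> S \<Longrightarrow> f \<in> mins S"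
| step: "g \<in> mins S \<Longrightarrow> f \<in> S \<Longrightarrow> (\<lambda>z. min (g z) (f z)) \<in> mins S"

text \<open>Like \<open>mins\<close>, left-nested on purpose: extending an expression needs only its
  current value and one new member of \<open>S\<close>, so a program can evaluate it with a single
  accumulator.\<close>

inductive_set maxs :: "('a \<Rightarrow> real) set \<Rightarrow> ('a \<Rightarrow> real) set" for S where
  base: "f \<in> S \<Longrightarrow> f \<in> maxs S"
| step: "g \<in> maxs S \<Longrightarrow> f \<in> S \<Longrightarrow> (\<lambda>z. max (g z) (f z)) \<in> maxs S"

lemma finite_min_in_mins:
  assumes "finite A" "A \<noteq> {}" "A \<subseteq> S"
  shows "\<exists>g\<in>mins S. \<forall>z. (\<forall>f\<in>A. g z \<le> f z) \<and> (\<exists>f\<in>A. g z = f z)"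
  using assms
proof (induction A rule: finite_ne_induct)
  case (singleton f)
  then show ?case by (intro bexI[of _ f]) (auto intro: mins.base)
next
  case (insert f A)
  then obtain g where g: "g \<in> mins S" "\<forall>z. (\<forall>f\<in>A. g z \<le> f z) \<and> (\<exists>f\<in>A. g z = f z)"
    by auto
  show ?case
  proof (rule bexI[of _ "\<lambda>z. min (g z) (f z)"])
    show "(\<lambda>z. min (g z) (f z)) \<in> mins S"
      using g insert by (auto intro: mins.step)
    have "\<exists>h\<in>insert f A. min (g z) (f z) = h z" for z
      using g(2) by (cases "g z \<le> f z") (auto simp: min_def)
    moreover have "min (g z) (f z) \<le> h z" if "h \<in> insert f A" for z h
      using g(2) that by (auto simp: min_le_iff_disj le_max_iff_disj)
    ultimately show "\<forall>z. (\<forall>h\<in>insert f A. min (g z) (f z) \<le> h z) \<and> (\<exists>h\<in>insert f A. min (g z) (f z) = h z)"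
      by blast
  qed
qed

lemma finite_max_in_maxs:
  assumes "finite A" "A \<noteq> {}" "A \<subseteq> S"
  shows "\<exists>g\<in>maxs S. \<forall>z. (\<forall>f\<in>A. f z \<le> g z) \<and> (\<exists>f\<in>A. g z = f z)"
  using assms
proof (induction A rule: finite_ne_induct)
  case (singleton f)
  then show ?case by (intro bexI[of _ f]) (auto intro: maxs.base)
next
  case (insert f A)
  then obtain g where g: "g \<in> maxs S" "\<forall>z. (\<forall>f\<in>A. f z \<le> g z) \<and> (\<exists>f\<in>A. g z = f z)"
    by auto
  show ?case
  proof (rule bexI[of _ "\<lambda>z. max (g z) (f z)"])
    show "(\<lambda>z. max (g z) (f z)) \<in> maxs S"
      using g insert by (auto intro: maxs.step)
    have "\<exists>h\<in>insert f A. max (g z) (f z) = h z" for z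
      using g(2) by (cases "g z \<le> f z") (auto simp: max_def)
    moreover have "h z \<le> max (g z) (f z)" if "h \<in> insert f A" for z h
      using g(2) that by (auto simp: min_le_iff_disj le_max_iff_disj)
    ultimately show "\<forall>z. (\<forall>h\<in>insert f A. h z \<le> max (g z) (f z)) \<and> (\<exists>h\<in>insert f A. max (g z) (f z) = h z)"
      by blast
  qed
qed

lemma continuous_map_mins:
  assumes "g \<in> mins S" "\<And>f. f \<in> S \<Longrightarrow> continuous_map X euclideanreal f"
  shows "continuous_map X euclideanreal g"
  using assms by induction (auto intro: continuous_map_real_min)

lemma openin_diff_less:
  fixes c :: real
  assumes "continuous_map X euclideanreal f" "continuous_map X euclideanreal g"
  shows "openin X {z \<in> topspace X. f z < g z + c}"
proof -
  have "continuous_map X euclideanreal (\<lambda>z. f z - g z)"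
    using assms by (intro continuous_map_diff)
  then have "openin X {z \<in> topspace X. f z - g z \<in> {..<c}}"
    by (rule openin_continuous_map_preimage) auto
  then show ?thesis by (simp add: algebra_simps)
qed

lemma compact_space_pointwise_cover:
  assumes X: "compact_space X"
    and U: "\<And>p. p \<in> topspace X \<Longrightarrow> openin X (U p)" "\<And>p. p \<in> topspace X \<Longrightarrow> p \<in> U p"
  shows "\<exists>T. finite T \<and> T \<subseteq> topspace X \<and> topspace X \<subseteq> \<Union>(U ` T)"
proof -
  have "\<exists>\<F>. finite \<F> \<and> \<F> \<subseteq> U ` topspace X \<and> topspace X \<subseteq> \<Union>\<F>"
    using X[unfolded compact_space_alt, rule_format, of "U ` topspace X"] U by blast
  then show ?thesis
    by (metis finite_subset_image)
qed

text \<open>Two coverings: interpolants through a fixed \<open>p\<close> are cut down by a finite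
  minimum to lie below \<open>F + e\<close> everywhere, and such minima, one for each
  \<open>p\<close>, are lifted above \<open>F - e\<close> by a finite maximum.\<close>

theorem lattice_Stone_Weierstrass:
  fixes F :: "'a \<Rightarrow> real"
  assumes X: "compact_space X" and S: "\<And>f. f \<in> S \<Longrightarrow> continuous_map X euclideanreal f"
    and F: "continuous_map X euclideanreal F" and ne: "S \<noteq> {}" and e: "e > 0"
    and interp: "\<And>p q. p \<in> topspace X \<Longrightarrow> q \<in> topspace X \<Longrightarrow> \<exists>f\<in>S. f p = F p \<and> f q = F q"
  shows "\<exists>h\<in>maxs (mins S). \<forall>z\<in>topspace X. \<bar>h z - F z\<bar> < e"
proof (cases "topspace X = {}")
  case True
  then show ?thesis using ne by (auto intro: maxs.base mins.base)
next
  case False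
  have below: "\<exists>g\<in>mins S. g p = F p \<and> (\<forall>z\<in>topspace X. g z < F z + e)"
    if p: "p \<in> topspace X" for p
  proof -
    obtain f where f: "\<And>q. q \<in> topspace X \<Longrightarrow> f q \<in> S \<and> f q p = F p \<and> f q q = F q"
      using interp[OF p] by metis
    obtain T where T: "finite T" "T \<subseteq> topspace X"
      "topspace X \<subseteq> \<Union>((\<lambda>q. {z \<in> topspace X. f q z < F z + e}) ` T)"
      using compact_space_pointwise_cover[OF X, of "\<lambda>q. {z \<in> topspace X. f q z < F z + e}"]
        openin_diff_less[OF S F] f e by auto
    have "T \<noteq> {}" using T False by auto
    then obtain g where g: "g \<in> mins S" "\<forall>z. (\<forall>h\<in>f ` T. g z \<le> h z) \<and> (\<exists>h\<in>f ` T. g z = h z)"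
      using finite_min_in_mins[of "f ` T" S] T f by auto
    \<comment> \<open>All interpolants \<open>f q\<close> agree with \<open>F\<close> at
      \<open>p\<close>, so whichever attains the minimum there has the value \<open>F p\<close>.
      This keeps the minimum close to \<open>F\<close> near \<open>p\<close> for the second
      covering.\<close>
    have "g p = F p"
    proof -
      obtain q where "q \<in> T" "g p = f q p" using g(2) by blast
      then show ?thesis using f T(2) by auto
    qed
    moreover have "g z < F z + e" if z: "z \<in> topspace X" for z
    proof -
      obtain q where "q \<in> T" "f q z < F z + e" using T(3) z by auto
      moreover have "g z \<le> f q z" using g(2) \<open>q \<in> T\<close> by blast
      ultimately show ?thesis by linarith
    qed
    ultimately show ?thesis using g(1) by auto
  qed
  then obtain g where g: "\<And>p. p \<in> topspace X \<Longrightarrow>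
      g p \<in> mins S \<and> g p p = F p \<and> (\<forall>z\<in>topspace X. g p z < F z + e)" by metis
  obtain T where T: "finite T" "T \<subseteq> topspace X"
    "topspace X \<subseteq> \<Union>((\<lambda>p. {z \<in> topspace X. F z < g p z + e}) ` T)"
    using compact_space_pointwise_cover[OF X, of "\<lambda>p. {z \<in> topspace X. F z < g p z + e}"]
      openin_diff_less[OF F continuous_map_mins[of _ S, OF _ S]] g e by auto
  have "T \<noteq> {}" using T False by auto
  then obtain h where h: "h \<in> maxs (mins S)"
    "\<forall>z. (\<forall>f\<in>g ` T. f z \<le> h z) \<and> (\<exists>f\<in>g ` T. h z = f z)"
    using finite_max_in_maxs[of "g ` T" "mins S"] T g by auto
  have "\<bar>h z - F z\<bar> < e" if z: "z \<in> topspace X" for z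
  proof -
    obtain p where p: "p \<in> T" "F z < g p z + e" using T(3) z by auto
    then have "g p z \<le> h z" using h(2) by auto
    \<comment> \<open>The maximum is attained by some \<open>g q\<close>, and each of these lies
      below \<open>F + e\<close> on the whole space, not just near \<open>q\<close>.\<close>
    moreover have "h z < F z + e"
    proof -
      obtain q where "q \<in> T" "h z = g q z" using h(2) by blast
      then show ?thesis using g T(2) z by auto
    qed
    ultimately show ?thesis using p by auto
  qed
  then show ?thesis using h(1) by auto
qed

section \<open>Weak* compactness of the space of probability measures\<close>

lemma summable_quarter: "summable (\<lambda>n. indicator (A n) x * (1/4::real) ^ n)"
  by (rule summable_comparison_test'[of "\<lambda>n. (1/4::real) ^ n"])
    (auto simp: summable_geometric indicator_def)

text \<open>The first index at which two digit sequences differ dominates the whole tail, as in a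
  Cantor set.\<close>

lemma quarter_series_separates:
  fixes A :: "nat \<Rightarrow> 'a set"
  defines "s \<equiv> \<lambda>x. (\<Sum>n. indicator (A n) x * (1/4::real) ^ n)"
  assumes "\<bar>s x - s y\<bar> < (1/4) ^ Suc N" "n \<le> N"
  shows "x \<in> A n \<longleftrightarrow> y \<in> A n"
proof (rule ccontr)
  assume "\<not> (x \<in> A n \<longleftrightarrow> y \<in> A n)"
  define m where "m = (LEAST n. \<not> (x \<in> A n \<longleftrightarrow> y \<in> A n))"
  have m: "\<not> (x \<in> A m \<longleftrightarrow> y \<in> A m)" "m \<le> N"
    using LeastI[of "\<lambda>n. \<not> (x \<in> A n \<longleftrightarrow> y \<in> A n)" n] Least_le[of "\<lambda>n. \<not> (x \<in> A n \<longleftrightarrow> y \<in> A n)" n]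
      \<open>\<not> (x \<in> A n \<longleftrightarrow> y \<in> A n)\<close> \<open>n \<le> N\<close> by (auto simp: m_def)
  have less: "x \<in> A k \<longleftrightarrow> y \<in> A k" if "k < m" for k
    using not_less_Least that unfolding m_def by blast
  define t where "t k = (indicator (A k) x - indicator (A k) y) * (1/4::real) ^ k" for k
  have t_sum: "summable t"
    using summable_diff[OF summable_quarter[of A x] summable_quarter[of A y]]
    by (simp add: t_def[abs_def] algebra_simps)
  have st: "s x - s y = suminf t"
    unfolding s_def t_def
    by (subst suminf_diff[OF summable_quarter summable_quarter]) (simp add: algebra_simps)
  have "suminf t = (\<Sum>k. t (k + Suc m)) + (\<Sum>k<Suc m. t k)"
    by (rule suminf_split_initial_segment[OF t_sum])
  also have "(\<Sum>k<Suc m. t k) = t m"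
    using less by (simp add: t_def indicator_def)
  finally have eq: "suminf t = (\<Sum>k. t (k + Suc m)) + t m" .
  \<comment> \<open>The ratio 1/4 leaves room: digit differences lie in {-1, 0, 1}, so the tail is
    at most a third of the leading term \<open>(1/4) ^ m\<close>. With ratio 1/2 the tail could
    cancel it.\<close>
  have geo: "(\<lambda>k. (1/4::real) ^ (k + Suc m)) sums ((4/3) * (1/4) ^ Suc m)"
    using sums_mult2[OF geometric_sums[of "1/4::real"], of "(1/4)^Suc m"] by (simp add: power_add)
  have "\<bar>\<Sum>k. t (k + Suc m)\<bar> \<le> (\<Sum>k. (1/4::real) ^ (k + Suc m))"
  proof (rule order_trans[OF summable_rabs])
    have le: "\<bar>t (k + Suc m)\<bar> \<le> (1/4::real) ^ (k + Suc m)" for k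
      by (auto simp: t_def indicator_def)
    show sm: "summable (\<lambda>k. \<bar>t (k + Suc m)\<bar>)"
      using geo le by (intro summable_comparison_test'[OF sums_summable[OF geo]]) auto
    show "(\<Sum>k. \<bar>t (k + Suc m)\<bar>) \<le> (\<Sum>k. (1/4::real) ^ (k + Suc m))"
      by (rule suminf_le[OF le sm sums_summable[OF geo]])
  qed
  also have "\<dots> = (1/3) * (1/4) ^ m" using sums_unique[OF geo] by simp
  finally have "\<bar>\<Sum>k. t (k + Suc m)\<bar> \<le> (1/3) * (1/4) ^ m" .
  moreover have "\<bar>t m\<bar> = (1/4) ^ m"
    using m(1) by (auto simp: t_def indicator_def)
  ultimately have "(1/4) ^ m * (2/3) \<le> \<bar>s x - s y\<bar>"
    unfolding st eq by linarith
  moreover have "(1/4::real) ^ N \<le> (1/4) ^ m"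
    using m(2) by (intro power_decreasing) auto
  moreover have "(0::real) < (1/4) ^ m" by simp
  ultimately show False using assms(2) unfolding power_Suc by linarith
qed

text \<open>A Borel encoding of \<open>\<Omega>\<close> by real numbers whose inverse is uniformly continuous. It reduces
  weak* compactness to Helly's selection theorem on the real line.\<close>

lemma borel_encoding:
  fixes \<Omega> :: "'a::{metric_space, second_countable_topology} set"
  assumes "compact \<Omega>"
  shows "\<exists>s::'a \<Rightarrow> real. s \<in> borel_measurable borel \<and> (\<forall>x. 0 \<le> s x \<and> s x \<le> 2) \<and>
    (\<forall>e>0. \<exists>\<delta>>0. \<forall>x\<in>\<Omega>. \<forall>y\<in>\<Omega>. \<bar>s x - s y\<bar> < \<delta> \<longrightarrow> dist x y < e)"
proof -
  obtain B :: "'a set set" where B: "countable B" "topological_basis B"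
    using ex_countable_basis by auto
  have "B \<noteq> {}" using B(2) topological_basisE[of B UNIV] by fastforce
  define A where "A = from_nat_into B"
  have A: "range A = B" using B(1) \<open>B \<noteq> {}\<close> by (simp add: A_def range_from_nat_into)
  have A_open: "open (A n)" for n
    using A topological_basis_open[OF B(2)] by auto
  define s where "s x = (\<Sum>n. indicator (A n) x * (1/4::real) ^ n)" for x
  have [measurable]: "A n \<in> sets borel" for n using A_open by auto
  have meas: "s \<in> borel_measurable borel" unfolding s_def by measurable
  have "0 \<le> s x" for x
    unfolding s_def by (intro suminf_nonneg summable_quarter) auto
  moreover have "s x \<le> 2" for x
  proof -
    have "s x \<le> (\<Sum>n. (1/4::real) ^ n)"
      unfolding s_def by (intro suminf_le summable_quarter) (auto simp: indicator_def summable_geometric)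
    also have "\<dots> \<le> 2" by (subst suminf_geometric) auto
    finally show ?thesis .
  qed
  moreover have "\<exists>\<delta>>0. \<forall>x\<in>\<Omega>. \<forall>y\<in>\<Omega>. \<bar>s x - s y\<bar> < \<delta> \<longrightarrow> dist x y < e" if "e > 0" for e
  proof -
    have "\<exists>n. x \<in> A n \<and> A n \<subseteq> ball x (e/2)" for x
    proof -
      obtain b where "b \<in> B" "x \<in> b" "b \<subseteq> ball x (e/2)"
        using topological_basisE[OF B(2), of "ball x (e/2)" x] \<open>e > 0\<close> by auto
      then show ?thesis using A by (metis rangeE)
    qed
    then obtain n where n: "\<And>x. x \<in> A (n x) \<and> A (n x) \<subseteq> ball x (e/2)" by metis
    obtain T where T: "finite T" "\<Omega> \<subseteq> (\<Union>x\<in>T. A (n x))"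
      using compactE_image[OF assms, of \<Omega> "\<lambda>x. A (n x)"] A_open n by (metis UN_I subsetI)
    \<comment> \<open>Agreement of the digits up to the largest index in the finite cover puts both
      points into a common member, which lies in a ball of radius \<open>e/2\<close>.\<close>
    define N where "N = Max (insert 0 (n ` T))"
    have N: "n x \<le> N" if "x \<in> T" for x using that T(1) by (auto simp: N_def)
    have "dist x y < e" if xy: "x \<in> \<Omega>" "y \<in> \<Omega>" "\<bar>s x - s y\<bar> < (1/4) ^ Suc N" for x y
    proof -
      obtain z where z: "z \<in> T" "x \<in> A (n z)" using T xy by auto
      then have "y \<in> A (n z)"
        using quarter_series_separates[of A x y N "n z"] xy(3) N by (auto simp: s_def)
      then have "dist z x < e/2" "dist z y < e/2" using n[of z] z by auto
      then show ?thesis by (metis dist_commute dist_triangle_half_r)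
    qed
    then show ?thesis by (intro exI[of _ "(1/4) ^ Suc N"]) auto
  qed
  ultimately show ?thesis using meas by blast
qed

lemma Prob_D:
  assumes "\<mu> \<in> Prob \<Omega>"
  shows "prob_space \<mu>" "sets \<mu> = sets borel" "emeasure \<mu> \<Omega> = 1" "space \<mu> = UNIV"
    "\<And>f :: vec \<Rightarrow> real. f \<in> borel_measurable \<mu> \<longleftrightarrow> f \<in> borel_measurable borel"
  using assms sets_eq_imp_space_eq[of \<mu> borel] measurable_cong_sets[of \<mu> borel borel borel]
  unfolding Prob_def by auto

lemma Prob_AE:
  assumes "\<mu> \<in> Prob \<Omega>" "compact \<Omega>"
  shows "AE x in \<mu>. x \<in> \<Omega>"
proof -
  interpret prob_space \<mu> using Prob_D[OF assms(1)] by auto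
  have "\<Omega> \<in> sets \<mu>" using Prob_D[OF assms(1)] assms(2) by (auto intro: borel_compact)
  then show ?thesis using Prob_D(3)[OF assms(1)]
    by (subst AE_in_set_eq_1) (auto simp: measure_def)
qed

text \<open>Test functions of \<open>weakstar\<close> are given on \<Omega> and integrated over
  \<Omega>, whereas \<open>Gamma\<close> integrates over the whole space; this passes between the
  two.\<close>

lemma Prob_set_integral:
  fixes f :: "vec \<Rightarrow> real"
  assumes "\<mu> \<in> Prob \<Omega>" "compact \<Omega>" "f \<in> borel_measurable borel"
  shows "(LINT y:\<Omega>|\<mu>. f y) = (LINT y|\<mu>. f y)"
  unfolding set_lebesgue_integral_def
proof (rule integral_cong_AE)
  have [measurable]: "\<Omega> \<in> sets borel" using assms(2) by (auto intro: borel_compact)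
  note [measurable] = assms(3)
  show "(\<lambda>x. indicator \<Omega> x *\<^sub>R f x) \<in> borel_measurable \<mu>" "f \<in> borel_measurable \<mu>"
    unfolding Prob_D(5)[OF assms(1)] by measurable
  show "AE x in \<mu>. indicator \<Omega> x *\<^sub>R f x = f x"
    using Prob_AE[OF assms(1,2)] by eventually_elim auto
qed

lemma Prob_integrable:
  fixes f :: "vec \<Rightarrow> real"
  assumes "\<mu> \<in> Prob \<Omega>" "compact \<Omega>" "f \<in> borel_measurable borel" "continuous_on \<Omega> f"
  shows "integrable \<mu> f"
proof -
  interpret prob_space \<mu> using Prob_D[OF assms(1)] by auto
  obtain B where B: "\<And>x. x \<in> \<Omega> \<Longrightarrow> norm (f x) \<le> B"
    using compact_imp_bounded[OF compact_continuous_image[OF assms(4,2)]]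
    by (auto simp: bounded_iff)
  have "AE x in \<mu>. norm (f x) \<le> B"
    using Prob_AE[OF assms(1,2)] by eventually_elim (rule B)
  then show ?thesis
    by (rule integrable_const_bound) (simp add: Prob_D(5)[OF assms(1)] assms(3))
qed

lemma Prob_set_integrable:
  fixes f :: "vec \<Rightarrow> real"
  assumes "\<mu> \<in> Prob \<Omega>" "compact \<Omega>" "continuous_on \<Omega> f"
  shows "set_integrable \<mu> \<Omega> f"
proof -
  interpret prob_space \<mu> using Prob_D[OF assms(1)] by auto
  have [measurable]: "\<Omega> \<in> sets borel" using assms(2) by (auto intro: borel_compact)
  obtain B where B: "\<And>x. x \<in> \<Omega> \<Longrightarrow> norm (f x) \<le> B"
    using compact_imp_bounded[OF compact_continuous_image[OF assms(3,2)]]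
    by (auto simp: bounded_iff)
  have "AE x in \<mu>. norm (indicator \<Omega> x *\<^sub>R f x) \<le> B"
    using Prob_AE[OF assms(1,2)] by eventually_elim (use B in auto)
  moreover have "(\<lambda>x. indicator \<Omega> x *\<^sub>R f x) \<in> borel_measurable borel"
    using assms(3) by (intro borel_measurable_continuous_on_indicator) auto
  ultimately show ?thesis unfolding set_integrable_def
    by (intro integrable_const_bound) (auto simp: Prob_D(5)[OF assms(1)])
qed

text \<open>The encoding \<open>s\<close> is merely Borel, but its uniformly continuous inverse
  extends to the closure \<open>C\<close> of the image. The extension \<open>g\<close> turns test
  functions on \<Omega> into continuous functions on \<open>C\<close> and carries the limit measure
  back.\<close>

lemma Prob_sequentially_compact:
  assumes \<Omega>: "compact \<Omega>" and \<mu>: "\<And>n. \<mu> n \<in> Prob \<Omega>"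
  shows "\<exists>r \<nu>. strict_mono (r :: nat \<Rightarrow> nat) \<and> \<nu> \<in> Prob \<Omega> \<and>
    (\<forall>f :: vec \<Rightarrow> real. continuous_on \<Omega> f \<longrightarrow>
      (\<lambda>n. LINT y:\<Omega>|\<mu> (r n). f y) \<longlonglongrightarrow> (LINT y:\<Omega>|\<nu>. f y))"
proof -
  have "\<Omega> \<noteq> {}" using Prob_D(3)[OF \<mu>[of 0]] by auto
  then obtain \<omega> where \<omega>: "\<omega> \<in> \<Omega>" by auto
  have [measurable]: "\<Omega> \<in> sets borel" using \<Omega> by (auto intro: borel_compact)
  obtain s :: "vec \<Rightarrow> real" where s[measurable]: "s \<in> borel_measurable borel"
    and s01: "\<And>x. 0 \<le> s x \<and> s x \<le> 2"
    and s_inv: "\<And>e. e > 0 \<Longrightarrow> \<exists>\<delta>>0. \<forall>x\<in>\<Omega>. \<forall>y\<in>\<Omega>. \<bar>s x - s y\<bar> < \<delta> \<longrightarrow> dist x y < e"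
    using borel_encoding[OF \<Omega>] by metis
  have s_meas: "s \<in> borel_measurable (\<mu> n)" for n
    using Prob_D(5)[OF \<mu>] by simp
  have s_gt: "-1 < s x" for x using s01[of x] by linarith
  define N where "N n = distr (\<mu> n) borel s" for n
  have N: "real_distribution (N n)" for n
    unfolding N_def using Prob_D(1)[OF \<mu>[of n]] s_meas[of n]
    by (intro prob_space.real_distribution_distr) auto
  have "tight N"
    unfolding tight_def
  proof (intro conjI allI impI)
    fix e :: real assume "e > 0"
    \<comment> \<open>Tightness is phrased with half-open intervals, so the left end has to lie
      strictly below the lower bound 0 of \<open>s\<close>.\<close>
    have "measure (N n) {-1<..2} = 1" for n
    proof -
      interpret real_distribution "N n" by (rule N)
      have "AE t in N n. t \<in> {-1<..2}"
        unfolding N_def using s01 s_gt by (subst AE_distr_iff[OF s_meas]) auto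
      then show ?thesis by (subst prob_eq_1) auto
    qed
    then show "\<exists>a b. a < b \<and> (\<forall>n. 1 - e < measure (N n) {a<..b})"
      using \<open>e > 0\<close> by (intro exI[of _ "-1"] exI[of _ 2]) auto
  qed (rule N)
  then obtain r M where r: "strict_mono (r :: nat \<Rightarrow> nat)" and M: "real_distribution M"
    and "weak_conv_m (N \<circ> id \<circ> r) M"
    using tight_imp_convergent_subsubsequence[of N id] strict_mono_id by (auto simp: id_def)
  then have conv: "weak_conv_m (\<lambda>n. N (r n)) M" by (simp add: comp_def)
  interpret M: real_distribution M by (rule M)
  define C where "C = closure (s ` \<Omega>)"
  have C: "closed C" "C \<noteq> {}" using \<open>\<Omega> \<noteq> {}\<close> by (auto simp: C_def)
  have "bounded (s ` \<Omega>)" by (rule boundedI[of _ 2]) (use s01 in force)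
  then have "compact C" by (simp add: C_def compact_eq_bounded_closed bounded_closure)
  have [measurable]: "C \<in> sets borel" using C by auto
  have inj: "inj_on s \<Omega>"
  proof (rule inj_onI, rule ccontr)
    fix x y assume *: "x \<in> \<Omega>" "y \<in> \<Omega>" "s x = s y" "x \<noteq> y"
    then obtain \<delta> where "\<delta> > 0" "\<forall>u\<in>\<Omega>. \<forall>v\<in>\<Omega>. \<bar>s u - s v\<bar> < \<delta> \<longrightarrow> dist u v < dist x y"
      using s_inv[of "dist x y"] by auto
    then show False using * by fastforce
  qed
  have inv: "inv_into \<Omega> s (s x) = x" if "x \<in> \<Omega>" for x
    using inj that by simp
  have "uniformly_continuous_on (s ` \<Omega>) (inv_into \<Omega> s)"
    unfolding uniformly_continuous_on_def
  proof (intro allI impI)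
    fix e :: real assume "e > 0"
    then obtain \<delta> where "\<delta> > 0" "\<forall>x\<in>\<Omega>. \<forall>y\<in>\<Omega>. \<bar>s x - s y\<bar> < \<delta> \<longrightarrow> dist x y < e"
      using s_inv by blast
    then show "\<exists>\<delta>>0. \<forall>x\<in>s ` \<Omega>. \<forall>x'\<in>s ` \<Omega>. dist x' x < \<delta> \<longrightarrow>
        dist (inv_into \<Omega> s x') (inv_into \<Omega> s x) < e"
      by (intro exI[of _ \<delta>]) (auto simp: inv dist_real_def)
  qed
  then obtain g where "uniformly_continuous_on C g" and "\<And>t. t \<in> s ` \<Omega> \<Longrightarrow> inv_into \<Omega> s t = g t"
    unfolding C_def by (rule uniformly_continuous_on_extension_on_closure) blast
  then have g: "continuous_on C g" and gs: "\<And>x. x \<in> \<Omega> \<Longrightarrow> g (s x) = x"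
    using inv by (auto intro: uniformly_continuous_imp_continuous)
  have "g ` C \<subseteq> \<Omega>"
    unfolding C_def using g gs \<Omega>
    by (intro image_closure_subset) (auto simp: C_def compact_imp_closed)
  then have g_in: "\<And>t. t \<in> C \<Longrightarrow> g t \<in> \<Omega>" by auto
  have sC: "s x \<in> C" if "x \<in> \<Omega>" for x
    using subsetD[OF closure_subset imageI[OF that]] by (simp add: C_def)
  \<comment> \<open>Off \<open>C\<close>, which will be a null set for \<open>M\<close>, the value
    is an arbitrary point of \<Omega>, so that the push-forward under \<open>G\<close> charges only
    \<Omega>.\<close>
  define G where "G t = (if t \<in> C then g t else \<omega>)" for t
  have G[measurable]: "G \<in> borel_measurable borel"
    unfolding G_def using g by (intro borel_measurable_continuous_on_if) auto
  have lim: "(\<lambda>n. LINT x|\<mu> (r n). k (s x)) \<longlonglongrightarrow> (LINT t|M. k t)"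
    if k: "continuous_on UNIV k" "\<And>t. norm (k t) \<le> B" for k :: "real \<Rightarrow> real" and B
  proof -
    have [measurable]: "k \<in> borel_measurable borel"
      using k(1) by (rule borel_measurable_continuous_onI)
    have "(\<lambda>n. integral\<^sup>L (N (r n)) k) \<longlonglongrightarrow> integral\<^sup>L M k"
      using k by (intro weak_conv_imp_integral_bdd_continuous_conv[OF N M conv])
        (auto simp: continuous_on_eq_continuous_at)
    then show ?thesis
      unfolding N_def by (simp add: integral_distr[OF s_meas])
  qed
  have MC: "AE t in M. t \<in> C"
  proof -
    \<comment> \<open>A bounded continuous test function vanishing exactly on \<open>C\<close>: its
      integrals along the sequence are zero, hence so is the limit.\<close>
    define k where "k t = min 1 (infdist t C)" for t
    have k: "continuous_on UNIV k" unfolding k_def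
      by (intro continuous_intros)
    have kb: "norm (k t) \<le> 1" "0 \<le> k t" for t
      by (auto simp: k_def infdist_nonneg)
    have [measurable]: "k \<in> borel_measurable borel"
      using k by (rule borel_measurable_continuous_onI)
    have "(LINT x|\<mu> n. k (s x)) = 0" for n
    proof (rule integral_eq_zero_AE)
      show "AE x in \<mu> n. k (s x) = 0"
        using Prob_AE[OF \<mu>[of n] \<Omega>] by eventually_elim (use sC C in \<open>auto simp: k_def\<close>)
    qed
    then have "(LINT t|M. k t) = 0"
      using lim[OF k kb(1)] by (simp add: LIMSEQ_const_iff)
    moreover have "integrable M k"
      using kb by (intro M.integrable_const_bound[of _ 1]) auto
    ultimately have "AE t in M. k t = 0"
      using kb by (subst (asm) integral_nonneg_eq_0_iff_AE) auto
    then show ?thesis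
      by eventually_elim (use C in \<open>auto simp: k_def min_def in_closed_iff_infdist_zero split: if_splits\<close>)
  qed
  define \<nu> where "\<nu> = distr M borel G"
  have \<nu>: "\<nu> \<in> Prob \<Omega>"
  proof -
    have "prob_space \<nu>" unfolding \<nu>_def by (intro M.prob_space_distr) auto
    moreover have "emeasure \<nu> \<Omega> = 1"
    proof -
      have "G -` \<Omega> = UNIV" using g_in \<omega> by (auto simp: G_def)
      then show ?thesis
        unfolding \<nu>_def using M.emeasure_space_1 by (subst emeasure_distr) auto
    qed
    ultimately show ?thesis by (auto simp: Prob_def \<nu>_def)
  qed
  have "(\<lambda>n. LINT y:\<Omega>|\<mu> (r n). f y) \<longlonglongrightarrow> (LINT y:\<Omega>|\<nu>. f y)"
    if f: "continuous_on \<Omega> f" for f :: "vec \<Rightarrow> real"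
  proof -
    have fm[measurable]: "(\<lambda>x. indicator \<Omega> x *\<^sub>R f x) \<in> borel_measurable borel"
      using f by (intro borel_measurable_continuous_on_indicator) auto
    have fg: "continuous_on C (f \<circ> g)"
      using g f g_in by (intro continuous_on_compose) (auto intro: continuous_on_subset)
    obtain B where "B > 0" "\<And>t. t \<in> C \<Longrightarrow> norm ((f \<circ> g) t) \<le> B"
      using compact_imp_bounded[OF compact_continuous_image[OF fg \<open>compact C\<close>]]
      by (auto simp: bounded_pos)
    \<comment> \<open>Weak convergence is tested by functions on the whole line, so
      \<open>f \<circ> g\<close> is extended from \<open>C\<close> with the same bound.\<close>
    then obtain k where k: "continuous_on UNIV k" "\<And>t. t \<in> C \<Longrightarrow> k t = f (g t)" "\<And>t. norm (k t) \<le> B"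
      using Tietze[OF fg, of UNIV B] C by auto
    have [measurable]: "k \<in> borel_measurable borel"
      using k(1) by (rule borel_measurable_continuous_onI)
    have "(LINT y:\<Omega>|\<mu> n. f y) = (LINT x|\<mu> n. k (s x))" for n
      unfolding set_lebesgue_integral_def
    proof (rule integral_cong_AE)
      show "AE x in \<mu> n. indicator \<Omega> x *\<^sub>R f x = k (s x)"
        using Prob_AE[OF \<mu>[of n] \<Omega>] by eventually_elim (use sC gs k in auto)
      show "(\<lambda>x. indicator \<Omega> x *\<^sub>R f x) \<in> borel_measurable (\<mu> n)"
        "(\<lambda>x. k (s x)) \<in> borel_measurable (\<mu> n)"
        unfolding Prob_D(5)[OF \<mu>] by measurable
    qed
    moreover have "(LINT y:\<Omega>|\<nu>. f y) = (LINT t|M. k t)"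
    proof -
      have "(LINT y:\<Omega>|\<nu>. f y) = (LINT t|M. indicator \<Omega> (G t) *\<^sub>R f (G t))"
        unfolding set_lebesgue_integral_def \<nu>_def
        by (rule integral_distr) (use G in simp, rule fm)
      also have "\<dots> = (LINT t|M. k t)"
      proof (rule integral_cong_AE)
        show "AE t in M. indicator \<Omega> (G t) *\<^sub>R f (G t) = k t"
          using MC by eventually_elim (use g_in k in \<open>auto simp: G_def\<close>)
        show "(\<lambda>t. indicator \<Omega> (G t) *\<^sub>R f (G t)) \<in> borel_measurable M"
          using measurable_compose[OF G fm] by simp
      qed auto
      finally show ?thesis .
    qed
    ultimately show ?thesis using lim[OF k(1,3)] by simp
  qed
  then show ?thesis using r \<nu> by blast
qed

section \<open>Exponential moments and uniform approximation by exponential sums\<close>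

lemma continuous_on_coord [continuous_intros]: "continuous_on S (\<lambda>y::vec. y i)"
  by (rule continuous_on_subset[OF continuous_on_product_coordinates]) auto

text \<open>Lists with repetition make the exponents additive under append, so products of
  exponentials are again of this kind; the empty list yields the constant 1.\<close>

definition lform :: "nat list \<Rightarrow> vec \<Rightarrow> real" where
  "lform l y = (\<Sum>i\<leftarrow>l. y i)"

text \<open>The index set is countable, so the moments live in a metrizable space.\<close>

definition exp_moment :: "vec set \<Rightarrow> vec measure \<Rightarrow> nat list \<Rightarrow> real" where
  "exp_moment \<Omega> \<mu> l = (LINT y:\<Omega>|\<mu>. exp (lform l y))"

lemma continuous_on_lform [continuous_intros]: "continuous_on S (lform l)"
  unfolding lform_def[abs_def] by (induction l) (auto intro!: continuous_intros)

inductive_set exp_polys :: "(vec \<Rightarrow> real) set" where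
  exp: "(\<lambda>y. exp (lform l y)) \<in> exp_polys"
| scale: "f \<in> exp_polys \<Longrightarrow> (\<lambda>y. c * f y) \<in> exp_polys"
| add: "f \<in> exp_polys \<Longrightarrow> g \<in> exp_polys \<Longrightarrow> (\<lambda>y. f y + g y) \<in> exp_polys"

lemma exp_polys_mult_exp:
  assumes "f \<in> exp_polys" shows "(\<lambda>y. exp (lform l y) * f y) \<in> exp_polys"
  using assms
proof induction
  case (exp k)
  then show ?case using exp_polys.exp[of "l @ k"] by (simp add: lform_def exp_add)
next
  case (scale f c)
  then show ?case using exp_polys.scale[of "\<lambda>y. exp (lform l y) * f y" c] by (simp add: mult.left_commute)
next
  case (add f g)
  then show ?case using exp_polys.add[OF add.IH] by (simp add: algebra_simps)
qed

lemma exp_polys_mult: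
  assumes "f \<in> exp_polys" "g \<in> exp_polys" shows "(\<lambda>y. f y * g y) \<in> exp_polys"
  using assms
proof induction
  case (exp k)
  then show ?case by (rule exp_polys_mult_exp)
next
  case (scale f c)
  then show ?case using exp_polys.scale[of "\<lambda>y. f y * g y" c] by (simp add: mult.assoc)
next
  case (add f h)
  then show ?case using exp_polys.add[of "\<lambda>y. f y * g y" "\<lambda>y. h y * g y"] by (simp add: algebra_simps)
qed

lemma continuous_on_exp_polys: "f \<in> exp_polys \<Longrightarrow> continuous_on S f"
  by (induction rule: exp_polys.induct) (auto intro!: continuous_intros)

lemma exp_polys_dense:
  assumes "compact \<Omega>" "continuous_on \<Omega> f" "e > 0"
  shows "\<exists>g\<in>exp_polys. \<forall>y\<in>\<Omega>. \<bar>f y - g y\<bar> < e"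
proof -
  interpret function_ring_on exp_polys \<Omega>
  proof
    fix c :: real show "(\<lambda>_. c) \<in> exp_polys"
      using exp_polys.scale[OF exp_polys.exp[of "[]"], of c] by (simp add: lform_def)
  next
    fix x y :: vec assume "x \<noteq> y"
    then obtain i where "x i \<noteq> y i" by auto
    then show "\<exists>f\<in>exp_polys. f x \<noteq> f y"
      by (intro bexI[OF _ exp_polys.exp[of "[i]"]]) (simp add: lform_def)
  qed (auto intro: assms continuous_on_exp_polys exp_polys.add exp_polys_mult)
  show ?thesis by (rule Stone_Weierstrass_basic[OF assms(2,3)])
qed

text \<open>By linearity the integral is a finite combination of moments, and each moment is a
  coordinate projection of the product space. Conditions on integrals thus become open conditions on
  moments.\<close>

lemma exp_polys_integral:
  assumes "f \<in> exp_polys" "compact \<Omega>"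
  shows "\<exists>L. continuous_on UNIV L \<and> (\<forall>\<mu>\<in>Prob \<Omega>. (LINT y:\<Omega>|\<mu>. f y) = L (exp_moment \<Omega> \<mu>))"
  using assms(1)
proof induction
  case (exp l)
  have "continuous_on UNIV (\<lambda>w::nat list \<Rightarrow> real. w l)"
    by (rule continuous_on_product_coordinates)
  then show ?case
    by (intro exI[of _ "\<lambda>w. w l"]) (auto simp: exp_moment_def)
next
  case (scale f c)
  then obtain L where "continuous_on UNIV L" "\<forall>\<mu>\<in>Prob \<Omega>. (LINT y:\<Omega>|\<mu>. f y) = L (exp_moment \<Omega> \<mu>)"
    by auto
  then show ?case
    by (intro exI[of _ "\<lambda>w. c * L w"]) (auto intro!: continuous_intros)
next
  case (add f g)
  then obtain L K where
    "continuous_on UNIV L" "\<forall>\<mu>\<in>Prob \<Omega>. (LINT y:\<Omega>|\<mu>. f y) = L (exp_moment \<Omega> \<mu>)"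
    "continuous_on UNIV K" "\<forall>\<mu>\<in>Prob \<Omega>. (LINT y:\<Omega>|\<mu>. g y) = K (exp_moment \<Omega> \<mu>)"
    by auto
  moreover have "(LINT y:\<Omega>|\<mu>. f y + g y) = (LINT y:\<Omega>|\<mu>. f y) + (LINT y:\<Omega>|\<mu>. g y)"
    if "\<mu> \<in> Prob \<Omega>" for \<mu>
    using add that assms(2) by (intro set_integral_add Prob_set_integrable continuous_on_exp_polys)
  ultimately show ?case
    by (intro exI[of _ "\<lambda>w. L w + K w"]) (auto intro!: continuous_intros)
qed

lemma Prob_integral_diff_le:
  fixes f g :: "vec \<Rightarrow> real"
  assumes \<mu>: "\<mu> \<in> Prob \<Omega>" and \<Omega>: "compact \<Omega>" and f: "continuous_on \<Omega> f" and g: "continuous_on \<Omega> g"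
    and le: "\<And>y. y \<in> \<Omega> \<Longrightarrow> \<bar>f y - g y\<bar> \<le> e"
  shows "\<bar>(LINT y:\<Omega>|\<mu>. f y) - (LINT y:\<Omega>|\<mu>. g y)\<bar> \<le> e"
proof -
  interpret prob_space \<mu> using Prob_D[OF \<mu>] by auto
  have int: "set_integrable \<mu> \<Omega> f" "set_integrable \<mu> \<Omega> g"
    using assms by (auto intro: Prob_set_integrable)
  then have "(LINT y:\<Omega>|\<mu>. f y) - (LINT y:\<Omega>|\<mu>. g y) = (LINT y:\<Omega>|\<mu>. f y - g y)"
    by (simp add: set_integral_diff)
  also have "\<bar>\<dots>\<bar> \<le> (LINT y|\<mu>. \<bar>indicator \<Omega> y *\<^sub>R (f y - g y)\<bar>)"
    unfolding set_lebesgue_integral_def by (rule integral_abs_bound)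
  also have "\<dots> \<le> (LINT y|\<mu>. e)"
  proof (rule integral_mono_AE)
    show "integrable \<mu> (\<lambda>y. \<bar>indicator \<Omega> y *\<^sub>R (f y - g y)\<bar>)"
      using set_integral_diff(1)[OF int] unfolding set_integrable_def by (rule integrable_abs)
    show "AE y in \<mu>. \<bar>indicator \<Omega> y *\<^sub>R (f y - g y)\<bar> \<le> e"
      using Prob_AE[OF \<mu> \<Omega>] by eventually_elim (use le in auto)
  qed auto
  finally show ?thesis by (simp add: prob_space)
qed

section \<open>The weak* topology seen through moments\<close>

lemma topspace_weakstar [simp]: "topspace (weakstar \<Omega>) = Prob \<Omega>"
proof -
  have "{\<mu> \<in> Prob \<Omega>. (LINT y:\<Omega>|\<mu>. 0) \<in> (UNIV::real set)} \<in> {{\<mu> \<in> Prob \<Omega>. (LINT y:\<Omega>|\<mu>. f y) \<in> U} | f U.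
        continuous_on \<Omega> (f :: vec \<Rightarrow> real) \<and> open U}"
    by (intro CollectI exI[of _ "\<lambda>_. 0"] exI[of _ UNIV]) auto
  then show ?thesis unfolding weakstar_def by auto
qed

lemma continuous_map_weakstar_integral:
  fixes f :: "vec \<Rightarrow> real"
  assumes "continuous_on \<Omega> f"
  shows "continuous_map (weakstar \<Omega>) euclideanreal (\<lambda>\<mu>. LINT y:\<Omega>|\<mu>. f y)"
  unfolding continuous_map_def
proof (intro conjI allI impI)
  fix U :: "real set" assume "openin euclideanreal U"
  then show "openin (weakstar \<Omega>) {\<mu> \<in> topspace (weakstar \<Omega>). (LINT y:\<Omega>|\<mu>. f y) \<in> U}"
    unfolding topspace_weakstar unfolding weakstar_def using assms
    by (intro topology_generated_by_Basis) auto
qed auto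

text \<open>Every weak* open set is a pull-back from moment space: finite intersections and unions
  pass through directly, and for a generating set the test function is replaced by a uniformly close
  exponential sum.\<close>

lemma weakstar_open_via_exp_moment:
  assumes \<Omega>: "compact \<Omega>" and U: "openin (weakstar \<Omega>) U" and "\<mu> \<in> U"
  shows "\<exists>V. open V \<and> exp_moment \<Omega> \<mu> \<in> V \<and> {\<nu> \<in> Prob \<Omega>. exp_moment \<Omega> \<nu> \<in> V} \<subseteq> U"
proof -
  have "generate_topology_on {{\<mu> \<in> Prob \<Omega>. (LINT y:\<Omega>|\<mu>. f y) \<in> U} | f U.
        continuous_on \<Omega> (f :: vec \<Rightarrow> real) \<and> open U} U"
    using U unfolding weakstar_def openin_topology_generated_by_iff .
  then have "\<forall>\<mu>\<in>U. \<exists>V. open V \<and> exp_moment \<Omega> \<mu> \<in> V \<and> {\<nu> \<in> Prob \<Omega>. exp_moment \<Omega> \<nu> \<in> V} \<subseteq> U"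
  proof induction
    case Empty
    then show ?case by simp
  next
    case (Int a b)
    show ?case
    proof
      fix \<mu> assume "\<mu> \<in> a \<inter> b"
      then have "\<mu> \<in> a" "\<mu> \<in> b" by auto
      obtain V where
        "open V" "exp_moment \<Omega> \<mu> \<in> V" "{\<nu> \<in> Prob \<Omega>. exp_moment \<Omega> \<nu> \<in> V} \<subseteq> a"
        using bspec[OF Int.IH(1) \<open>\<mu> \<in> a\<close>] by auto
      moreover obtain W where
        "open W" "exp_moment \<Omega> \<mu> \<in> W" "{\<nu> \<in> Prob \<Omega>. exp_moment \<Omega> \<nu> \<in> W} \<subseteq> b"
        using bspec[OF Int.IH(2) \<open>\<mu> \<in> b\<close>] by auto
      ultimately show "\<exists>V. open V \<and> exp_moment \<Omega> \<mu> \<in> V \<and> {\<nu> \<in> Prob \<Omega>. exp_moment \<Omega> \<nu> \<in> V} \<subseteq> a \<inter> b"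
        by (intro exI[of _ "V \<inter> W"]) auto
    qed
  next
    case (UN K)
    show ?case
    proof
      fix \<mu> assume "\<mu> \<in> \<Union>K"
      then obtain k where "k \<in> K" "\<mu> \<in> k" by auto
      moreover obtain V where
        "open V" "exp_moment \<Omega> \<mu> \<in> V" "{\<nu> \<in> Prob \<Omega>. exp_moment \<Omega> \<nu> \<in> V} \<subseteq> k"
        using bspec[OF UN.IH[OF \<open>k \<in> K\<close>] \<open>\<mu> \<in> k\<close>] by auto
      ultimately show "\<exists>V. open V \<and> exp_moment \<Omega> \<mu> \<in> V \<and> {\<nu> \<in> Prob \<Omega>. exp_moment \<Omega> \<nu> \<in> V} \<subseteq> \<Union>K"
        by (intro exI[of _ V]) auto
    qed
  next
    case (Basis s)
    then obtain f and W :: "real set" where s: "s = {\<mu> \<in> Prob \<Omega>. (LINT y:\<Omega>|\<mu>. f y) \<in> W}"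
      and f: "continuous_on \<Omega> f" and W: "open W" by auto
    show ?case
    proof
      fix \<mu> assume "\<mu> \<in> s"
      then have \<mu>: "\<mu> \<in> Prob \<Omega>" "(LINT y:\<Omega>|\<mu>. f y) \<in> W" by (auto simp: s)
      then obtain r where r: "r > 0" "ball (LINT y:\<Omega>|\<mu>. f y) r \<subseteq> W"
        using W open_contains_ball by blast
      \<comment> \<open>One third of \<open>r\<close> pays for the approximation at \<mu>, one for
        that at \<nu>, and one for the ball around the approximate integral.\<close>
      then obtain g where g: "g \<in> exp_polys" "\<forall>y\<in>\<Omega>. \<bar>f y - g y\<bar> < r/3"
        using exp_polys_dense[OF \<Omega> f, of "r/3"] by auto
      obtain L where L: "continuous_on UNIV L"
        "\<And>\<mu>. \<mu> \<in> Prob \<Omega> \<Longrightarrow> (LINT y:\<Omega>|\<mu>. g y) = L (exp_moment \<Omega> \<mu>)"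
        using exp_polys_integral[OF g(1) \<Omega>] by blast
      have close: "\<bar>(LINT y:\<Omega>|\<nu>. f y) - L (exp_moment \<Omega> \<nu>)\<bar> \<le> r/3" if "\<nu> \<in> Prob \<Omega>" for \<nu>
        using Prob_integral_diff_le[OF that \<Omega> f continuous_on_exp_polys[OF g(1)], of "r/3"] g(2) L(2)[OF that]
        by (simp add: less_imp_le)
      define V where "V = L -` ball (L (exp_moment \<Omega> \<mu>)) (r/3)"
      have "open V" unfolding V_def using L(1) by (intro open_vimage) auto
      moreover have "exp_moment \<Omega> \<mu> \<in> V" using r by (auto simp: V_def)
      moreover have "\<nu> \<in> s" if "\<nu> \<in> Prob \<Omega>" "exp_moment \<Omega> \<nu> \<in> V" for \<nu>
      proof -
        have "\<bar>L (exp_moment \<Omega> \<mu>) - L (exp_moment \<Omega> \<nu>)\<bar> < r/3"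
          using that by (auto simp: V_def dist_real_def)
        then have "\<bar>(LINT y:\<Omega>|\<mu>. f y) - (LINT y:\<Omega>|\<nu>. f y)\<bar> < r"
          using close[OF \<mu>(1)] close[OF that(1)] by linarith
        then have "(LINT y:\<Omega>|\<nu>. f y) \<in> ball (LINT y:\<Omega>|\<mu>. f y) r" by (simp add: dist_real_def)
        then show ?thesis using r(2) that(1) by (auto simp: s)
      qed
      ultimately show "\<exists>V. open V \<and> exp_moment \<Omega> \<mu> \<in> V \<and> {\<nu> \<in> Prob \<Omega>. exp_moment \<Omega> \<nu> \<in> V} \<subseteq> s"
        by blast
    qed
  qed
  then show ?thesis using \<open>\<mu> \<in> U\<close> by blast
qed

text \<open>Subsequence limits are what Helly's theorem supplies; in a countable product of lines,
  which is metrizable, they give compactness by covers.\<close>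

lemma compact_exp_moments:
  assumes "compact \<Omega>" shows "compact (exp_moment \<Omega> ` Prob \<Omega>)"
proof -
  have "seq_compact (exp_moment \<Omega> ` Prob \<Omega>)"
  proof (rule seq_compactI)
    fix w :: "nat \<Rightarrow> nat list \<Rightarrow> real" assume "\<forall>n. w n \<in> exp_moment \<Omega> ` Prob \<Omega>"
    then have "\<forall>n. \<exists>\<mu>\<in>Prob \<Omega>. w n = exp_moment \<Omega> \<mu>" by blast
    then obtain \<mu> where \<mu>: "\<And>n. \<mu> n \<in> Prob \<Omega>" "\<And>n. w n = exp_moment \<Omega> (\<mu> n)" by metis
    obtain r \<nu> where r: "strict_mono r" "\<nu> \<in> Prob \<Omega>"
      "\<And>f :: vec \<Rightarrow> real. continuous_on \<Omega> f \<Longrightarrow>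
        (\<lambda>n. LINT y:\<Omega>|\<mu> (r n). f y) \<longlonglongrightarrow> (LINT y:\<Omega>|\<nu>. f y)"
      using Prob_sequentially_compact[OF assms, of \<mu>] \<mu>(1) by metis
    have "(\<lambda>n. w (r n) l) \<longlonglongrightarrow> exp_moment \<Omega> \<nu> l" for l
      unfolding \<mu>(2) exp_moment_def by (intro r(3) continuous_intros)
    then have "(w \<circ> r) \<longlonglongrightarrow> exp_moment \<Omega> \<nu>"
      using limitin_componentwise[of "\<lambda>_. euclideanreal" UNIV "w \<circ> r" "exp_moment \<Omega> \<nu>" sequentially]
      by (simp add: euclidean_product_topology)
    then show "\<exists>l\<in>exp_moment \<Omega> ` Prob \<Omega>. \<exists>r. strict_mono r \<and> (w \<circ> r) \<longlonglongrightarrow> l"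
      using r by blast
  qed
  then show ?thesis by (simp add: seq_compact_eq_compact)
qed

text \<open>A cover is refined by preimages of open sets of moments, and the finite subcover is
  extracted in moment space.\<close>

theorem compact_space_weakstar:
  assumes "compact \<Omega>" shows "compact_space (weakstar \<Omega>)"
  unfolding compact_space_alt topspace_weakstar
proof (intro allI impI)
  fix \<U> assume *: "(\<forall>U\<in>\<U>. openin (weakstar \<Omega>) U) \<and> Prob \<Omega> \<subseteq> \<Union>\<U>"
  have "\<forall>\<mu>\<in>Prob \<Omega>. \<exists>U V. U \<in> \<U> \<and> open V \<and> exp_moment \<Omega> \<mu> \<in> V \<and> {\<nu> \<in> Prob \<Omega>. exp_moment \<Omega> \<nu> \<in> V} \<subseteq> U"
  proof
    fix \<mu> assume "\<mu> \<in> Prob \<Omega>"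
    then obtain U where "U \<in> \<U>" "\<mu> \<in> U" using * by blast
    moreover have "openin (weakstar \<Omega>) U" using * \<open>U \<in> \<U>\<close> by simp
    ultimately show "\<exists>U V. U \<in> \<U> \<and> open V \<and> exp_moment \<Omega> \<mu> \<in> V \<and> {\<nu> \<in> Prob \<Omega>. exp_moment \<Omega> \<nu> \<in> V} \<subseteq> U"
      using weakstar_open_via_exp_moment[OF assms, of U \<mu>] by auto
  qed
  then obtain U V where UV: "\<And>\<mu>. \<mu> \<in> Prob \<Omega> \<Longrightarrow> U \<mu> \<in> \<U>"
    "\<And>\<mu>. \<mu> \<in> Prob \<Omega> \<Longrightarrow> open (V \<mu>)" "\<And>\<mu>. \<mu> \<in> Prob \<Omega> \<Longrightarrow> exp_moment \<Omega> \<mu> \<in> V \<mu>"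
    "\<And>\<mu> \<nu>. \<mu> \<in> Prob \<Omega> \<Longrightarrow> \<nu> \<in> Prob \<Omega> \<Longrightarrow> exp_moment \<Omega> \<nu> \<in> V \<mu> \<Longrightarrow> \<nu> \<in> U \<mu>"
    unfolding bchoice_iff subset_iff mem_Collect_eq by metis
  obtain T where T: "T \<subseteq> Prob \<Omega>" "finite T" "exp_moment \<Omega> ` Prob \<Omega> \<subseteq> (\<Union>\<mu>\<in>T. V \<mu>)"
    by (rule compactE_image[OF compact_exp_moments[OF assms] UV(2)]) (use UV(3) in auto)
  show "\<exists>\<F>. finite \<F> \<and> \<F> \<subseteq> \<U> \<and> Prob \<Omega> \<subseteq> \<Union>\<F>"
  proof (intro exI[of _ "U ` T"] conjI subsetI)
    fix \<nu> assume \<nu>: "\<nu> \<in> Prob \<Omega>"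
    then obtain \<mu> where "\<mu> \<in> T" "exp_moment \<Omega> \<nu> \<in> V \<mu>" using T(3) by blast
    then show "\<nu> \<in> \<Union>(U ` T)" using UV(4)[of \<mu> \<nu>] T(1) \<nu> by auto
  qed (use T UV in auto)
qed

section \<open>Ridge features\<close>

text \<open>Difference quotients of ReLU in the bias are bounded by 1 and tend pointwise to the
  indicator of \<open>{b<..}\<close>, so dominated convergence recovers the tail
  probability.\<close>

lemma step_integral_via_relu:
  fixes b :: real
  assumes "real_distribution M" and int: "\<And>b. integrable M (\<lambda>t. max 0 (t + b))"
  shows "(\<lambda>n. real (Suc n) * ((LINT t|M. max 0 (t + - b)) - (LINT t|M. max 0 (t + (- b - 1 / real (Suc n))))))
    \<longlonglongrightarrow> measure M {b<..}"
proof -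
  interpret real_distribution M by fact
  let ?\<phi> = "\<lambda>n t. real (Suc n) * (max 0 (t + - b) - max 0 (t + (- b - 1 / real (Suc n))))"
  have diff: "\<bar>max 0 (t + - b) - max 0 (t + (- b - h))\<bar> \<le> h"
    "h < t - b \<Longrightarrow> max 0 (t + - b) - max 0 (t + (- b - h)) = h"
    "t \<le> b \<Longrightarrow> max 0 (t + - b) - max 0 (t + (- b - h)) = 0" if "0 < h" for t h :: real
    using that by (auto simp: max_def)
  have "(\<lambda>n. LINT t|M. ?\<phi> n t) \<longlonglongrightarrow> (LINT t|M. indicator {b<..} t)"
  proof (rule integral_dominated_convergence[of _ _ _ "\<lambda>_. 1"])
    show "AE t in M. norm (?\<phi> n t) \<le> 1" for n
    proof (rule AE_I2)
      fix t
      have "\<bar>max 0 (t + - b) - max 0 (t + (- b - 1 / real (Suc n)))\<bar> \<le> 1 / real (Suc n)"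
        by (rule diff(1)) simp
      then have "real (Suc n) * \<bar>max 0 (t + - b) - max 0 (t + (- b - 1 / real (Suc n)))\<bar> \<le>
          real (Suc n) * (1 / real (Suc n))"
        by (rule mult_left_mono) simp
      then show "norm (?\<phi> n t) \<le> 1"
        unfolding real_norm_def abs_mult by simp
    qed
    show "AE t in M. (\<lambda>n. ?\<phi> n t) \<longlonglongrightarrow> indicator {b<..} t"
    proof (rule AE_I2)
      fix t
      show "(\<lambda>n. ?\<phi> n t) \<longlonglongrightarrow> indicator {b<..} t"
      proof (cases "b < t")
        case True
        obtain m where m: "1 / real (Suc m) < t - b"
          using reals_Archimedean[of "t - b"] True by (auto simp: inverse_eq_divide)
        have "?\<phi> n t = 1" if "n \<ge> m" for n
        proof -
          have "1 / real (Suc n) \<le> 1 / real (Suc m)" using that by (simp add: frac_le)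
          then have "1 / real (Suc n) < t - b" using m by linarith
          then have "max 0 (t + - b) - max 0 (t + (- b - 1 / real (Suc n))) = 1 / real (Suc n)"
            by (intro diff(2)) simp
          then show ?thesis by simp
        qed
        then have "eventually (\<lambda>n. ?\<phi> n t = 1) sequentially"
          unfolding eventually_sequentially by blast
        then show ?thesis using True by (simp add: tendsto_eventually)
      next
        case False
        have "?\<phi> n t = 0" for n
          using diff(3)[of "1 / real (Suc n)" t] False by simp
        then show ?thesis using False by simp
      qed
    qed
  qed auto
  moreover have "(LINT t|M. ?\<phi> n t) =
      real (Suc n) * ((LINT t|M. max 0 (t + - b)) - (LINT t|M. max 0 (t + (- b - 1 / real (Suc n)))))" for n
    by (simp only: integral_mult_right_zero Bochner_Integration.integral_diff[OF int int])
  ultimately show ?thesis by simp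
qed

lemma real_distribution_eq_relu:
  assumes M: "real_distribution M" "\<And>b. integrable M (\<lambda>t. max 0 (t + b))"
    and N: "real_distribution N" "\<And>b. integrable N (\<lambda>t. max 0 (t + b))"
    and eq: "\<And>b. (LINT t|M. max 0 (t + b)) = (LINT t|N. max 0 (t + b))"
  shows "M = N"
proof (rule cdf_unique[OF M(1) N(1)], rule ext)
  fix b
  interpret M: real_distribution M by fact
  interpret N: real_distribution N by fact
  have "measure M {b<..} = measure N {b<..}"
    using step_integral_via_relu[OF M, of b] step_integral_via_relu[OF N, of b]
    unfolding eq by (rule LIMSEQ_unique)
  moreover have "- {b<..} = {..b}" by auto
  ultimately show "cdf M b = cdf N b"
    using M.prob_compl[of "{b<..}"] N.prob_compl[of "{b<..}"]
    by (simp add: cdf_def Compl_eq_Diff_UNIV[symmetric])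
qed

definition ridge :: "nat \<Rightarrow> vec \<Rightarrow> real \<Rightarrow> vec \<Rightarrow> real" where
  "ridge d c b y = max 0 (inner_n d c y + b)"

lemma continuous_on_inner_n [continuous_intros]: "continuous_on S (inner_n d c)"
  unfolding inner_n_def[abs_def] by (intro continuous_intros)

lemma continuous_on_ridge [continuous_intros]: "continuous_on S (ridge d c b)"
  unfolding ridge_def[abs_def] by (intro continuous_intros)

lemma borel_measurable_inner_n [measurable]: "inner_n d c \<in> borel_measurable borel"
  by (intro borel_measurable_continuous_onI continuous_intros)

lemma borel_measurable_ridge [measurable]: "ridge d c b \<in> borel_measurable borel"
  by (intro borel_measurable_continuous_onI continuous_intros)

text \<open>List entries at or above \<open>d\<close> contribute nothing on \<open>in_dim d\<close>,
  so the linear forms in the moments are among those seen by ridges of dimension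
  \<open>d\<close>.\<close>

lemma lform_eq_inner_n: "\<exists>c. \<forall>y\<in>in_dim d. lform l y = inner_n d c y"
proof (induction l)
  case Nil
  show ?case by (intro exI[of _ "\<lambda>_. 0"]) (simp add: lform_def inner_n_def)
next
  case (Cons a l)
  then obtain c where c: "\<And>y. y \<in> in_dim d \<Longrightarrow> lform l y = inner_n d c y" by blast
  have "lform (a # l) y = inner_n d (\<lambda>j. c j + (if j = a then 1 else 0)) y" if "y \<in> in_dim d" for y
  proof -
    have "lform (a # l) y = y a + inner_n d c y" using c[OF that] by (simp add: lform_def)
    also have "y a = (\<Sum>j<d. (if j = a then 1 else 0) * y j)"
      using that by (auto simp: in_dim_def if_distrib[of "\<lambda>x. x * _"] cong: if_cong)
    finally show ?thesis by (simp add: inner_n_def algebra_simps sum.distrib)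
  qed
  then show ?case by blast
qed

text \<open>An exponential moment is the integral of \<open>exp\<close> against the law of one
  linear form, and the ridges in that direction with all biases fix this law through its
  distribution function.\<close>

lemma exp_moment_eq_of_ridges:
  assumes \<Omega>: "compact \<Omega>" "\<Omega> \<subseteq> in_dim d" and \<mu>: "\<mu> \<in> Prob \<Omega>" and \<nu>: "\<nu> \<in> Prob \<Omega>"
    and eq: "\<And>c b. (LINT y|\<mu>. ridge d c b y) = (LINT y|\<nu>. ridge d c b y)"
  shows "exp_moment \<Omega> \<mu> = exp_moment \<Omega> \<nu>"
proof
  fix l
  obtain c where c: "\<And>y. y \<in> \<Omega> \<Longrightarrow> lform l y = inner_n d c y"
    using lform_eq_inner_n[of d l] \<Omega>(2) by blast
  have moment: "exp_moment \<Omega> \<kappa> l = (LINT t|distr \<kappa> borel (inner_n d c). exp t)" if "\<kappa> \<in> Prob \<Omega>" for \<kappa>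
  proof -
    have "exp_moment \<Omega> \<kappa> l = (LINT y:\<Omega>|\<kappa>. exp (inner_n d c y))"
      unfolding exp_moment_def set_lebesgue_integral_def
      by (rule Bochner_Integration.integral_cong) (auto simp: c indicator_def)
    also have "\<dots> = (LINT y|\<kappa>. exp (inner_n d c y))"
      by (rule Prob_set_integral[OF that \<Omega>(1)]) measurable
    finally show ?thesis
      by (subst integral_distr) (auto simp: Prob_D(5)[OF that])
  qed
  have dist: "real_distribution (distr \<kappa> borel (inner_n d c))"
    "integrable (distr \<kappa> borel (inner_n d c)) (\<lambda>t. max 0 (t + b))"
    "(LINT t|distr \<kappa> borel (inner_n d c). max 0 (t + b)) = (LINT y|\<kappa>. ridge d c b y)"
    if "\<kappa> \<in> Prob \<Omega>" for \<kappa> b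
  proof -
    have m: "inner_n d c \<in> borel_measurable \<kappa>" by (simp add: Prob_D(5)[OF that])
    show "real_distribution (distr \<kappa> borel (inner_n d c))"
      using Prob_D(1)[OF that] m by (rule prob_space.real_distribution_distr)
    have "integrable \<kappa> (ridge d c b)"
      by (rule Prob_integrable[OF that \<Omega>(1)]) (auto intro!: continuous_intros)
    then show "integrable (distr \<kappa> borel (inner_n d c)) (\<lambda>t. max 0 (t + b))"
      by (subst integrable_distr_eq[OF m]) (auto simp: ridge_def[abs_def])
    show "(LINT t|distr \<kappa> borel (inner_n d c). max 0 (t + b)) = (LINT y|\<kappa>. ridge d c b y)"
      by (subst integral_distr[OF m]) (auto simp: ridge_def[abs_def])
  qed
  have "distr \<mu> borel (inner_n d c) = distr \<nu> borel (inner_n d c)"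
    by (rule real_distribution_eq_relu) (simp_all add: dist[OF \<mu>] dist[OF \<nu>] eq)
  then show "exp_moment \<Omega> \<mu> l = exp_moment \<Omega> \<nu> l"
    by (simp add: moment \<mu> \<nu>)
qed

text \<open>The bracketed sum is exactly what an averaging head leaves in a register that held the
  ridge value.\<close>

definition feature :: "nat \<Rightarrow> real \<Rightarrow> vec \<Rightarrow> real \<Rightarrow> vec \<Rightarrow> real \<Rightarrow> vec measure \<times> vec \<Rightarrow> real" where
  "feature d a \<beta> \<gamma> c b = (\<lambda>(\<mu>, x). a + inner_n d \<beta> x + \<gamma> * (ridge d c b x + (LINT y|\<mu>. ridge d c b y)))"

definition features :: "nat \<Rightarrow> (vec measure \<times> vec \<Rightarrow> real) set" where
  "features d = {feature d a \<beta> \<gamma> c b | a \<beta> \<gamma> c b. True}"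

lemma feature_in_features: "feature d a \<beta> \<gamma> c b \<in> features d"
  unfolding features_def by blast

lemma continuous_map_feature:
  assumes "compact \<Omega>"
  shows "continuous_map (prod_topology (weakstar \<Omega>) (top_of_set \<Omega>)) euclideanreal (feature d a \<beta> \<gamma> c b)"
    (is "continuous_map ?X _ _")
proof -
  have snd: "continuous_map ?X euclideanreal (\<lambda>z. f (snd z))" if "continuous_on \<Omega> f" for f :: "vec \<Rightarrow> real"
    using continuous_map_compose[OF continuous_map_snd, of "top_of_set \<Omega>" euclideanreal f "weakstar \<Omega>"] that
    by (simp add: comp_def)
  have fst: "continuous_map ?X euclideanreal (\<lambda>z. LINT y|fst z. ridge d c b y)"
  proof (rule continuous_map_eq)
    show "continuous_map ?X euclideanreal (\<lambda>z. LINT y:\<Omega>|fst z. ridge d c b y)"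
      using continuous_map_compose[OF continuous_map_fst continuous_map_weakstar_integral[OF continuous_on_ridge]]
      by (simp add: comp_def)
  qed (auto simp: Prob_set_integral[OF _ assms])
  have "continuous_map ?X euclideanreal (\<lambda>z. a + inner_n d \<beta> (snd z) +
      \<gamma> * (ridge d c b (snd z) + (LINT y|fst z. ridge d c b y)))"
    by (intro continuous_map_add continuous_map_real_mult snd fst continuous_intros) auto
  then show ?thesis by (simp add: feature_def case_prod_unfold)
qed

lemma two_point_interpolation:
  fixes u v :: real
  assumes "u \<noteq> v" shows "\<exists>a \<gamma>. a + \<gamma> * u = s \<and> a + \<gamma> * v = t"
proof -
  define \<gamma> where "\<gamma> = (s - t) / (u - v)"
  have "\<gamma> * (u - v) = s - t" using assms by (simp add: \<gamma>_def)
  then show ?thesis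
    by (intro exI[of _ "s - \<gamma> * u"] exI[of _ \<gamma>]) (simp add: algebra_simps)
qed

text \<open>Different positions are told apart by a coordinate; at equal positions, different
  moments provide a separating ridge; if both agree, continuity forces equal values of
  \<open>F\<close> and a constant serves.\<close>

lemma features_interpolate:
  assumes \<Omega>: "compact \<Omega>" "\<Omega> \<subseteq> in_dim d"
    and F: "continuous_map (prod_topology (weakstar \<Omega>) (top_of_set \<Omega>)) euclideanreal F"
    and p: "p \<in> Prob \<Omega> \<times> \<Omega>" and q: "q \<in> Prob \<Omega> \<times> \<Omega>"
  shows "\<exists>f\<in>features d. f p = F p \<and> f q = F q"
proof -
  obtain \<mu> x \<nu> y where pq: "p = (\<mu>, x)" "q = (\<nu>, y)" by (metis surj_pair)
  then have *: "\<mu> \<in> Prob \<Omega>" "x \<in> \<Omega>" "\<nu> \<in> Prob \<Omega>" "y \<in> \<Omega>" using p q by auto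
  consider "x \<noteq> y" | "x = y" "exp_moment \<Omega> \<mu> \<noteq> exp_moment \<Omega> \<nu>" | "x = y" "exp_moment \<Omega> \<mu> = exp_moment \<Omega> \<nu>"
    by blast
  then show ?thesis
  proof cases
    case 1
    then obtain i where i: "x i \<noteq> y i" by auto
    have "i < d"
    proof (rule ccontr)
      assume "\<not> i < d"
      then have "z i = 0" if "z \<in> \<Omega>" for z using \<Omega>(2) that by (auto simp: in_dim_def)
      then show False using i *(2,4) by metis
    qed
    obtain a \<gamma> where a: "a + \<gamma> * x i = F p" "a + \<gamma> * y i = F q"
      using two_point_interpolation[OF i] by blast
    have "inner_n d (\<lambda>j. if j = i then \<gamma> else 0) z = \<gamma> * z i" for z
      using \<open>i < d\<close> by (simp add: inner_n_def if_distrib[of "\<lambda>x. x * _"] cong: if_cong)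
    then show ?thesis using a
      by (intro bexI[of _ "feature d a (\<lambda>j. if j = i then \<gamma> else 0) 0 (\<lambda>_. 0) 0"])
        (auto simp: feature_in_features, auto simp: feature_def pq)
  next
    case 2
    then obtain c b where "(LINT y|\<mu>. ridge d c b y) \<noteq> (LINT y|\<nu>. ridge d c b y)"
      using exp_moment_eq_of_ridges[OF \<Omega> *(1,3)] by blast
    then have "ridge d c b x + (LINT y|\<mu>. ridge d c b y) \<noteq> ridge d c b y + (LINT y|\<nu>. ridge d c b y)"
      using 2 by simp
    from two_point_interpolation[OF this] obtain a \<gamma> where
      "a + \<gamma> * (ridge d c b x + (LINT y|\<mu>. ridge d c b y)) = F p"
      "a + \<gamma> * (ridge d c b y + (LINT y|\<nu>. ridge d c b y)) = F q" by blast
    then show ?thesis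
      by (intro bexI[of _ "feature d a (\<lambda>_. 0) \<gamma> c b"])
        (auto simp: feature_in_features, auto simp: feature_def pq inner_n_def)
  next
    case 3
    have "F p = F q"
    proof (rule ccontr)
      assume ne: "F p \<noteq> F q"
      have pair: "continuous_map (weakstar \<Omega>) (prod_topology (weakstar \<Omega>) (top_of_set \<Omega>)) (\<lambda>\<kappa>. (\<kappa>, x))"
        using *(2) by (intro continuous_map_pairedI) auto
      have "continuous_map (weakstar \<Omega>) euclideanreal (\<lambda>\<kappa>. F (\<kappa>, x))"
        using continuous_map_compose[OF pair F] by (simp add: comp_def)
      \<comment> \<open>The weak* open set where \<open>F\<close> avoids the value
        \<open>F q\<close> would contain \<mu> but not \<nu>, although equal moments put both into
        the same weak* open sets.\<close>
      then have "openin (weakstar \<Omega>) {\<kappa> \<in> topspace (weakstar \<Omega>). F (\<kappa>, x) \<in> - {F q}}"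
        by (rule openin_continuous_map_preimage) auto
      moreover have "\<mu> \<in> {\<kappa> \<in> topspace (weakstar \<Omega>). F (\<kappa>, x) \<in> - {F q}}"
        using ne * pq by auto
      ultimately obtain V where "exp_moment \<Omega> \<mu> \<in> V"
        "{\<kappa> \<in> Prob \<Omega>. exp_moment \<Omega> \<kappa> \<in> V} \<subseteq> {\<kappa> \<in> topspace (weakstar \<Omega>). F (\<kappa>, x) \<in> - {F q}}"
        using weakstar_open_via_exp_moment[OF \<Omega>(1)] by meson
      then show False using 3 * pq by auto
    qed
    then show ?thesis
      by (intro bexI[of _ "feature d (F p) (\<lambda>_. 0) 0 (\<lambda>_. 0) 0"])
        (auto simp: feature_in_features, auto simp: feature_def pq inner_n_def)
  qed
qed

lemma features_approximate:
  assumes \<Omega>: "compact \<Omega>" "\<Omega> \<subseteq> in_dim d"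
    and F: "continuous_map (prod_topology (weakstar \<Omega>) (top_of_set \<Omega>)) euclideanreal F"
    and "e > 0"
  shows "\<exists>h\<in>maxs (mins (features d)). \<forall>z\<in>Prob \<Omega> \<times> \<Omega>. \<bar>h z - F z\<bar> < e"
proof -
  have "compact_space (prod_topology (weakstar \<Omega>) (top_of_set \<Omega>))"
    using compact_space_weakstar[OF \<Omega>(1)] \<Omega>(1)
    by (simp add: compact_space_prod_topology compact_space_subtopology)
  then have "\<exists>h\<in>maxs (mins (features d)). \<forall>z\<in>topspace (prod_topology (weakstar \<Omega>) (top_of_set \<Omega>)). \<bar>h z - F z\<bar> < e"
  proof (rule lattice_Stone_Weierstrass[OF _ _ F])
    show "continuous_map (prod_topology (weakstar \<Omega>) (top_of_set \<Omega>)) euclideanreal f"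
      if "f \<in> features d" for f
      using that continuous_map_feature[OF \<Omega>(1)] by (auto simp: features_def)
    show "features d \<noteq> {}" using feature_in_features by blast
  qed (use features_interpolate[OF \<Omega> F] \<open>e > 0\<close> in auto)
  then show ?thesis by simp
qed

section \<open>Exact evaluation of max-min expressions by transformers\<close>

lemma sum_lessThan_add: "(\<Sum>j<n + m. f j) = (\<Sum>j<n. f j) + (\<Sum>j<m. f (n + j) :: real)" for n m :: nat
  by (induction m) (auto simp: add.assoc)

text \<open>A single ReLU unit shared by all output coordinates is enough, since a block alters at
  most one register nonlinearly.\<close>

definition relu_form :: "nat \<Rightarrow> nat \<Rightarrow> mat \<Rightarrow> vec \<Rightarrow> vec \<Rightarrow> vec \<Rightarrow> real \<Rightarrow> vec \<Rightarrow> vec" where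
  "relu_form n m A b c w \<tau> x = (\<lambda>i. if i < m
     then inner_n n (A i) x + b i + c i * max 0 (inner_n n w x + \<tau>) else 0)"

text \<open>The identity channels pass through the hidden layer as \<open>max 0 x - max 0 (- x)\<close>.\<close>

lemma relu_form_mlp:
  "\<exists>F. mlp_valid F \<and> mlp_in F = n \<and> mlp_out F = m \<and> mlp_eval F = relu_form n m A b c w \<tau>"
proof -
  define A1 where "A1 j i = (if j < n then if i = j then 1 else 0
     else if j < n + n then if i = j - n then - 1 else 0 else w i :: real)" for j i :: nat
  define b1 where "b1 j = (if j < n + n then 0 else \<tau>)" for j :: nat
  define A2 where "A2 i j = (if j < n then A i j else if j < n + n then - A i (j - n) else c i)" for i j
  define F where "F = (n, [(A1, b1, n + n + 1), (A2, b, m)])"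
  have "mlp_eval F x i = relu_form n m A b c w \<tau> x i" for x i
  proof (cases "i < m")
    case True
    define h where "h = relu (affine n (n + n + 1) A1 b1 x)"
    have h: "h j = max 0 (x j)" "h (n + j) = max 0 (- x j)" if "j < n" for j
      using that by (auto simp: h_def relu_def affine_def A1_def b1_def
          if_distrib[of "\<lambda>x. x * _"] cong: if_cong)
    have h': "h (n + n) = max 0 (inner_n n w x + \<tau>)"
      by (simp add: h_def relu_def affine_def A1_def b1_def inner_n_def)
    have split: "(\<Sum>j<n. A i j * max 0 (x j)) - (\<Sum>j<n. A i j * max 0 (- x j)) = inner_n n (A i) x"
      unfolding inner_n_def sum_subtractf[symmetric] right_diff_distrib[symmetric]
      by (intro sum.cong) (auto simp: max_def)
    have "mlp_eval F x i = (\<Sum>j<n + n + 1. A2 i j * h j) + b i"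
      using True by (simp add: mlp_eval_def F_def h_def affine_def)
    also have "(\<Sum>j<n + n + 1. A2 i j * h j) =
        (\<Sum>j<n. A2 i j * h j) + (\<Sum>j<n. A2 i (n + j) * h (n + j)) + A2 i (n + n) * h (n + n)"
      by (simp add: sum_lessThan_add)
    also have "\<dots> = inner_n n (A i) x + c i * max 0 (inner_n n w x + \<tau>)"
      using split by (simp add: A2_def h h' sum_negf)
    finally show ?thesis using True by (simp add: relu_form_def)
  next
    case False
    then show ?thesis by (simp add: mlp_eval_def F_def affine_def relu_form_def)
  qed
  then have "mlp_eval F = relu_form n m A b c w \<tau>" by blast
  then show ?thesis
    by (intro exI[of _ F]) (auto simp: F_def mlp_valid_def mlp_in_def mlp_out_def)
qed

lemma borel_measurable_coordinatewise:
  fixes f :: "'a \<Rightarrow> vec"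
  assumes "\<And>i. (\<lambda>x. f x i) \<in> borel_measurable M"
  shows "f \<in> borel_measurable M"
  using assms by (rule measurable_coordinatewise_then_product)

lemma borel_measurable_coord: "(\<lambda>y::vec. y i) \<in> borel_measurable borel"
  by (intro borel_measurable_continuous_onI continuous_intros)

lemma borel_measurable_relu_form [measurable]: "relu_form n m A b c w \<tau> \<in> borel_measurable borel"
  unfolding relu_form_def[abs_def] by (rule borel_measurable_coordinatewise) simp

text \<open>Query and key are zero, so the softmax weights are uniform.\<close>

definition mean_attn :: "bool \<Rightarrow> nat \<Rightarrow> attn" where
  "mean_attn h n = \<lparr>a_din = n, a_dhead = 1, a_k = 1, a_heads =
     (if h then [(\<lambda>i j. if i = n - 1 then 1 else 0, \<lambda>i j. 0, \<lambda>i j. 0, \<lambda>i j. if j = n - 1 then 1 else 0)]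
      else [])\<rparr>"

definition add_mean :: "bool \<Rightarrow> nat \<Rightarrow> real \<Rightarrow> vec \<Rightarrow> vec" where
  "add_mean h n m x = (\<lambda>i. if i < n then x i + (if h \<and> i = n - 1 then m else 0) else 0)"

lemma Gamma_mean_attn:
  assumes "prob_space \<mu>" "h \<Longrightarrow> 0 < n"
  shows "Gamma (mean_attn h n) \<mu> = add_mean h n (LINT y|\<mu>. y (n - 1))"
proof -
  interpret prob_space \<mu> by fact
  have *: "(\<Sum>j<n. (if j = n - Suc 0 then 1 else 0) * y j) = y (n - Suc 0)" if h for y :: vec
    using assms(2)[OF that] by (simp add: if_distrib[of "\<lambda>x. x * _"] cong: if_cong)
  show ?thesis
    by (cases h; intro ext)
      (simp_all add: Gamma_def mean_attn_def add_mean_def Let_def mat_vec_def inner_n_def * prob_space)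
qed

lemma borel_measurable_add_mean [measurable]: "add_mean h n m \<in> borel_measurable borel"
  unfolding add_mean_def[abs_def]
  by (rule borel_measurable_coordinatewise) (simp add: borel_measurable_coord)

text \<open>As \<open>transformer []\<close> is the identity, the separate singleton equation fits
  the same recursion, and blocks can be prepended uniformly.\<close>

lemma transformer_Cons:
  "transformer ((\<theta>, F) # bs) \<mu> x =
    transformer bs (distr \<mu> borel (\<lambda>x. mlp_eval F (Gamma \<theta> \<mu> x))) (mlp_eval F (Gamma \<theta> \<mu> x))"
  by (cases bs) (auto simp: icomp_def ctx_free_def)

text \<open>A recursive form of the indexed side conditions of the theorem, suited to prepending
  blocks: widths lead from \<open>n\<close> to \<open>m\<close>, \<open>B\<close> bounds the
  attention widths and \<open>H\<close> the numbers of heads.\<close>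

fun chain :: "nat \<Rightarrow> nat \<Rightarrow> nat \<Rightarrow> nat \<Rightarrow> (attn \<times> mlp) list \<Rightarrow> bool" where
  "chain B H n m [] \<longleftrightarrow> n = m"
| "chain B H n m ((\<theta>, F) # bs) \<longleftrightarrow> a_din \<theta> = n \<and> mlp_valid F \<and> mlp_in F = n \<and> n \<le> B \<and>
     a_dhead \<theta> = 1 \<and> a_k \<theta> = 1 \<and> a_H \<theta> \<le> H \<and> chain B H (mlp_out F) m bs"

lemma chain_nth:
  assumes "chain B H n m bs" "l < length bs"
  shows "mlp_valid (snd (bs ! l)) \<and> mlp_in (snd (bs ! l)) = a_din (fst (bs ! l)) \<and>
    mlp_out (snd (bs ! l)) = (if Suc l < length bs then a_din (fst (bs ! Suc l)) else m) \<and>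
    a_din (fst (bs ! l)) \<le> B \<and> a_dhead (fst (bs ! l)) = 1 \<and> a_k (fst (bs ! l)) = 1 \<and>
    a_H (fst (bs ! l)) \<le> H"
  using assms
proof (induction bs arbitrary: n l)
  case (Cons a bs)
  obtain \<theta> F where a: "a = (\<theta>, F)" by (cases a)
  show ?case
  proof (cases l)
    case 0
    have "mlp_out F = (if Suc 0 < length (a # bs) then a_din (fst ((a # bs) ! Suc 0)) else m)"
      using Cons.prems(1) by (cases bs) (auto simp: a)
    then show ?thesis using Cons.prems(1) 0 by (auto simp: a)
  next
    case (Suc k)
    then show ?thesis using Cons.IH[of "mlp_out F" k] Cons.prems by (simp add: a)
  qed
qed simp

section \<open>A register machine acting on tokens\<close>

locale register_machine =
  fixes d d' :: nat and \<Omega> :: "vec set" and R :: "nat \<Rightarrow> vec measure \<times> vec \<Rightarrow> real"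
  assumes d'_pos: "0 < d'"
begin

definition N :: nat where "N = d + d' + 2"

text \<open>\<open>realizes n G\<close>: tokens that are distributed like the image of the input under \<open>G\<close> can
  still be processed to \<open>R\<close>. Programs are thus built backwards, from the output layer.\<close>

definition realizes :: "nat \<Rightarrow> icmap \<Rightarrow> bool" where
  "realizes n G \<longleftrightarrow> (\<exists>bs. bs \<noteq> [] \<and> chain (d + 3 * d') d' n d' bs \<and>
     (\<forall>\<mu>\<in>Prob \<Omega>. \<forall>x. \<forall>i<d'. transformer bs (distr \<mu> borel (G \<mu>)) (G \<mu> x) i = R i (\<mu>, x)))"

text \<open>\<open>realizes\<close> asks for a nonempty program, so the second alternative admits a
  block followed by nothing. Successive push-forwards compose, which keeps tokens a function of the
  original token and measure.\<close>

lemma realizes_block: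
  assumes G': "realizes n' G' \<or>
      n' = d' \<and> (\<forall>\<mu> x i. \<mu> \<in> Prob \<Omega> \<longrightarrow> i < d' \<longrightarrow> G' \<mu> x i = R i (\<mu>, x))" and n: "h \<Longrightarrow> 0 < n" "n \<le> d + 3 * d'"
    and G: "\<And>\<mu>. \<mu> \<in> Prob \<Omega> \<Longrightarrow> G \<mu> \<in> borel_measurable borel"
    and eq: "\<And>\<mu> x. \<mu> \<in> Prob \<Omega> \<Longrightarrow>
      relu_form n n' A b c w \<tau> (add_mean h n (LINT y|\<mu>. G \<mu> y (n - 1)) (G \<mu> x)) = G' \<mu> x"
  shows "realizes n G"
proof -
  obtain bs where bs: "chain (d + 3 * d') d' n' d' bs"
    "\<And>\<mu> x i. \<mu> \<in> Prob \<Omega> \<Longrightarrow> i < d' \<Longrightarrow> transformer bs (distr \<mu> borel (G' \<mu>)) (G' \<mu> x) i = R i (\<mu>, x)"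
  proof (cases "realizes n' G'")
    case True
    then show ?thesis using that unfolding realizes_def by blast
  next
    case False
    then show ?thesis using that[of "[]"] G' by simp
  qed
  obtain F where F: "mlp_valid F" "mlp_in F = n" "mlp_out F = n'" "mlp_eval F = relu_form n n' A b c w \<tau>"
    using relu_form_mlp by blast
  have "transformer ((mean_attn h n, F) # bs) (distr \<mu> borel (G \<mu>)) (G \<mu> x) i = R i (\<mu>, x)"
    if \<mu>: "\<mu> \<in> Prob \<Omega>" and "i < d'" for \<mu> x i
  proof -
    have m: "G \<mu> \<in> measurable \<mu> borel"
      unfolding measurable_cong_sets[OF Prob_D(2)[OF \<mu>] refl] by (rule G[OF \<mu>])
    have P: "prob_space (distr \<mu> borel (G \<mu>))"
      by (rule prob_space.prob_space_distr[OF Prob_D(1)[OF \<mu>] m])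
    \<comment> \<open>The mean over the current tokens becomes an integral over the original
      measure, so registers can be described as functions of \<open>(\<mu>, x)\<close>.\<close>
    have mean: "(LINT y|distr \<mu> borel (G \<mu>). y (n - 1)) = (LINT y|\<mu>. G \<mu> y (n - 1))"
      by (rule integral_distr[OF m borel_measurable_coord])
    have blk: "(\<lambda>z. mlp_eval F (Gamma (mean_attn h n) (distr \<mu> borel (G \<mu>)) z)) =
        (\<lambda>z. relu_form n n' A b c w \<tau> (add_mean h n (LINT y|\<mu>. G \<mu> y (n - 1)) z))" (is "_ = ?\<phi>")
      by (simp only: F(4) Gamma_mean_attn[OF P n(1)] mean)
    have \<phi>: "?\<phi> \<in> measurable borel borel" by measurable
    have "distr (distr \<mu> borel (G \<mu>)) borel ?\<phi> = distr \<mu> borel (?\<phi> \<circ> G \<mu>)"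
      by (rule distr_distr[OF \<phi> m])
    also have "?\<phi> \<circ> G \<mu> = G' \<mu>" using eq[OF \<mu>] by (auto simp: comp_def)
    finally show ?thesis
      using bs(2)[OF \<mu> \<open>i < d'\<close>, of x] eq[OF \<mu>, of x]
      by (simp add: transformer_Cons blk fun_cong[OF blk])
  qed
  moreover have "chain (d + 3 * d') d' n d' ((mean_attn h n, F) # bs)"
    using bs(1) F n d'_pos by (auto simp: mean_attn_def a_H_def)
  ultimately show ?thesis unfolding realizes_def by blast
qed

text \<open>The scratch register \<open>S\<close> comes last because \<open>mean_attn\<close> reads
  and writes the index \<open>N - 1\<close>.\<close>

definition state where
  "state Y P S \<mu> x = (\<lambda>i. if i < d then x i else if i < d + d' then Y (i - d) (\<mu>, x)
     else if i = d + d' then P (\<mu>, x) else if i = d + d' + 1 then S (\<mu>, x) else 0 :: real)"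

definition form :: "vec \<Rightarrow> nat \<Rightarrow> real \<Rightarrow> real \<Rightarrow> real \<Rightarrow> vec" where
  "form \<beta> k u v s = (\<lambda>j. if j < d then \<beta> j else if j < d + d' then if j = d + k then u else 0
     else if j = d + d' then v else s)"

text \<open>Push-forwards require measurability in the token for each fixed measure; \<mu> is only a
  parameter.\<close>

definition mf :: "(vec measure \<times> vec \<Rightarrow> real) \<Rightarrow> bool" where
  "mf P \<longleftrightarrow> (\<forall>\<mu>\<in>Prob \<Omega>. (\<lambda>x. P (\<mu>, x)) \<in> borel_measurable borel)"

lemma inner_state:
  assumes "k < d'"
  shows "inner_n N (form \<beta> k u v s) (state Y P S \<mu> x) =
    inner_n d \<beta> x + u * Y k (\<mu>, x) + v * P (\<mu>, x) + s * S (\<mu>, x)"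
proof -
  have "(\<Sum>j<d'. (if j = k then u else 0) * Y j (\<mu>, x)) = u * Y k (\<mu>, x)"
    using assms by (simp add: if_distrib[of "\<lambda>x. x * _"] cong: if_cong)
  then show ?thesis
    by (simp add: inner_n_def N_def sum_lessThan_add numeral_2_eq_2 form_def state_def)
qed

lemma borel_measurable_state:
  assumes "\<And>k. mf (Y k)" "mf P" "mf S" "\<mu> \<in> Prob \<Omega>"
  shows "state Y P S \<mu> \<in> borel_measurable borel"
  unfolding state_def[abs_def]
proof (rule borel_measurable_coordinatewise)
  fix i
  consider "i < d" | "\<not> i < d" "i < d + d'" | "i = d + d'" | "i = d + d' + 1" | "i > d + d' + 1"
    by linarith
  then show "(\<lambda>x. if i < d then x i else if i < d + d' then Y (i - d) (\<mu>, x)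
     else if i = d + d' then P (\<mu>, x) else if i = d + d' + 1 then S (\<mu>, x) else 0) \<in> borel_measurable borel"
    by cases (use assms in \<open>simp_all add: mf_def borel_measurable_coord\<close>)
qed

lemma state_upd_S: "v = T (\<mu>, x) \<Longrightarrow> (state Y P S \<mu> x)(d + d' + 1 := v) = state Y P T \<mu> x"
  by (auto simp: state_def fun_eq_iff)

lemma state_upd_P: "v = T (\<mu>, x) \<Longrightarrow> (state Y P S \<mu> x)(d + d' := v) = state Y T S \<mu> x"
  by (auto simp: state_def fun_eq_iff)

lemma state_upd_Y:
  "k < d' \<Longrightarrow> v = T (\<mu>, x) \<Longrightarrow> (state Y P S \<mu> x)(d + k := v) = state (Y(k := T)) P S \<mu> x"
  by (auto simp: state_def fun_eq_iff)

lemma inner_n_zero [simp]: "inner_n n (\<lambda>_. 0) x = 0"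
  by (simp add: inner_n_def)

text \<open>\<open>S'\<close> is the scratch register after attention, which the MLP already sees.
  Only register \<open>t\<close> is then rewritten, so all other rows are unit vectors.\<close>

lemma realizes_update:
  assumes upd: "realizes N (\<lambda>\<mu> x. (state Y P S' \<mu> x)
      (t := inner_n N r (state Y P S' \<mu> x) + b + c * max 0 (inner_n N w (state Y P S' \<mu> x) + \<tau>)))"
    and S': "\<And>\<mu> x. S' (\<mu>, x) = S (\<mu>, x) + (if h then LINT y|\<mu>. S (\<mu>, y) else 0)"
    and t: "t < N" and mf: "\<And>k. mf (Y k)" "mf P" "mf S"
  shows "realizes N (state Y P S)"
proof (rule realizes_block[OF disjI1[OF upd], where h = h and
      A = "\<lambda>i. if i = t then r else (\<lambda>j. if j = i then 1 else 0)" and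
      b = "\<lambda>i. if i = t then b else 0" and c = "\<lambda>i. if i = t then c else 0" and w = w and \<tau> = \<tau>])
  \<comment> \<open>The second bound amounts to \<open>d' + 2 \<le> 3 * d'\<close>, which is where
    \<open>d' \<ge> 1\<close> enters.\<close>
  show "0 < N" "N \<le> d + 3 * d'" using d'_pos by (auto simp: N_def)
  show "state Y P S \<mu> \<in> borel_measurable borel" if "\<mu> \<in> Prob \<Omega>" for \<mu>
    using mf that by (rule borel_measurable_state)
  fix \<mu> x assume "\<mu> \<in> Prob \<Omega>"
  have Z: "add_mean h N (LINT y|\<mu>. state Y P S \<mu> y (N - 1)) (state Y P S \<mu> x) = state Y P S' \<mu> x"
    by (auto simp: fun_eq_iff add_mean_def state_def N_def S')
  have unit: "inner_n N (\<lambda>j. if j = i then 1 else 0) z = z i" if "i < N" for i z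
    using that by (simp add: inner_n_def if_distrib[of "\<lambda>x. x * _"] cong: if_cong)
  show "relu_form N N (\<lambda>i. if i = t then r else (\<lambda>j. if j = i then 1 else 0))
      (\<lambda>i. if i = t then b else 0) (\<lambda>i. if i = t then c else 0) w \<tau>
      (add_mean h N (LINT y|\<mu>. state Y P S \<mu> y (N - 1)) (state Y P S \<mu> x)) =
    (state Y P S' \<mu> x)
      (t := inner_n N r (state Y P S' \<mu> x) + b + c * max 0 (inner_n N w (state Y P S' \<mu> x) + \<tau>))"
    unfolding Z using t by (auto simp: relu_form_def fun_eq_iff unit) (auto simp: state_def N_def)
qed

text \<open>Quantified over the scratch contents, because earlier computations leave a residue there
  that is overwritten before its next use.\<close>

definition runs where
  "runs Y P \<longleftrightarrow> (\<forall>S. mf S \<longrightarrow> realizes N (state Y P S))"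

lemma mf_feature: "mf (feature d a \<beta> \<gamma> c b)"
  by (auto simp: mf_def feature_def)

text \<open>Two blocks per feature: a head with uniform weights averages only linear functions of
  the tokens and acts before the MLP of its block, so the ridge must be stored by one block before
  the next can average it.\<close>

lemma runs_with_feature_register:
  assumes step: "\<And>S'. mf S' \<Longrightarrow> (\<And>\<mu> x. S' (\<mu>, x) = ridge d c b x + (LINT y|\<mu>. ridge d c b y)) \<Longrightarrow>
      realizes N (\<lambda>\<mu> x. (state Y P S' \<mu> x)
      (t := inner_n N r (state Y P S' \<mu> x) + e + q * max 0 (inner_n N w (state Y P S' \<mu> x) + \<tau>)))"
    and t: "t < N" and mf: "\<And>k. mf (Y k)" "mf P"
  shows "runs Y P"
  unfolding runs_def
proof (intro allI impI)
  fix S assume S: "mf S"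
  define S0 where "S0 = (\<lambda>(\<mu>::vec measure, x). ridge d c b x)"
  define S1 where "S1 = (\<lambda>(\<mu>, x). ridge d c b x + (LINT y|\<mu>. ridge d c b y))"
  have mfS: "mf S0" "mf S1" by (auto simp: mf_def S0_def S1_def)
  \<comment> \<open>The later block, with its head: attention turns \<open>S0\<close> into
    \<open>S1\<close> before the step is applied.\<close>
  have "realizes N (state Y P S0)"
    by (rule realizes_update[OF step[OF mfS(2)], where h = True]) (use t mf mfS in \<open>auto simp: S0_def S1_def\<close>)
  \<comment> \<open>The earlier block, without a head: the zero row erases the old scratch value and
    the ReLU unit writes the ridge.\<close>
  moreover have "(\<lambda>\<mu> x. (state Y P S \<mu> x)(d + d' + 1 := inner_n N (\<lambda>_. 0) (state Y P S \<mu> x) + 0 +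
      1 * max 0 (inner_n N (form c 0 0 0 0) (state Y P S \<mu> x) + b))) = state Y P S0"
    by (rule ext, rule ext, rule state_upd_S) (simp add: inner_state d'_pos S0_def ridge_def)
  ultimately show "realizes N (state Y P S)"
    by (intro realizes_update[where h = False and S' = S and S = S and Y = Y and P = P and t = "d + d' + 1" and
        r = "\<lambda>_. 0" and b = 0 and c = 1 and w = "form c 0 0 0 0" and \<tau> = b])
      (use mf S in \<open>auto simp: N_def\<close>)
qed

lemma runs_load:
  assumes f: "f \<in> features d" and mf: "\<And>k. mf (Y k)" "mf P" and run: "runs Y f"
  shows "runs Y P"
proof -
  obtain a \<beta> \<gamma> c b where f_eq: "f = feature d a \<beta> \<gamma> c b" using f by (auto simp: features_def)
  show ?thesis
  proof (rule runs_with_feature_register[where t = "d + d'" and r = "form \<beta> 0 0 0 \<gamma>" and e = a and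
        q = 0 and w = "\<lambda>_. 0" and \<tau> = 0 and c = c and b = b])
    fix S' assume S': "mf S'" "\<And>\<mu> x. S' (\<mu>, x) = ridge d c b x + (LINT y|\<mu>. ridge d c b y)"
    have "(\<lambda>\<mu> x. (state Y P S' \<mu> x)(d + d' := inner_n N (form \<beta> 0 0 0 \<gamma>) (state Y P S' \<mu> x) + a +
        0 * max 0 (inner_n N (\<lambda>_. 0) (state Y P S' \<mu> x) + 0))) = state Y f S'"
      by (rule ext, rule ext, rule state_upd_P) (simp add: inner_state d'_pos f_eq feature_def S')
    then show "realizes N (\<lambda>\<mu> x. (state Y P S' \<mu> x)(d + d' := inner_n N (form \<beta> 0 0 0 \<gamma>) (state Y P S' \<mu> x) + a +
        0 * max 0 (inner_n N (\<lambda>_. 0) (state Y P S' \<mu> x) + 0)))"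
      using run S' by (simp add: runs_def)
  qed (use mf in \<open>auto simp: N_def\<close>)
qed

lemma runs_min:
  assumes f: "f \<in> features d" and mf: "\<And>k. mf (Y k)" "mf P" and run: "runs Y (\<lambda>z. min (P z) (f z))"
  shows "runs Y P"
proof -
  obtain a \<beta> \<gamma> c b where f_eq: "f = feature d a \<beta> \<gamma> c b" using f by (auto simp: features_def)
  have neg: "inner_n d (\<lambda>j. - \<beta> j) x = - inner_n d \<beta> x" for x
    by (simp add: inner_n_def sum_negf)
  have min: "min u v = u + - 1 * max 0 (u - v)" for u v :: real by simp
  show ?thesis
  \<comment> \<open>The ReLU argument encodes \<open>P - f\<close>, with \<open>f\<close> read off
    from the position and the scratch register and never stored.\<close>
  proof (rule runs_with_feature_register[where t = "d + d'" and r = "form (\<lambda>_. 0) 0 0 1 0" and e = 0 and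
        q = "-1" and w = "form (\<lambda>j. - \<beta> j) 0 0 1 (- \<gamma>)" and \<tau> = "- a" and c = c and b = b])
    fix S' assume S': "mf S'" "\<And>\<mu> x. S' (\<mu>, x) = ridge d c b x + (LINT y|\<mu>. ridge d c b y)"
    have "(\<lambda>\<mu> x. (state Y P S' \<mu> x)(d + d' := inner_n N (form (\<lambda>_. 0) 0 0 1 0) (state Y P S' \<mu> x) + 0 +
        - 1 * max 0 (inner_n N (form (\<lambda>j. - \<beta> j) 0 0 1 (- \<gamma>)) (state Y P S' \<mu> x) + - a))) =
        state Y (\<lambda>z. min (P z) (f z)) S'"
      unfolding min
      by (rule ext, rule ext, rule state_upd_P)
        (simp add: inner_state d'_pos f_eq feature_def S' neg algebra_simps)
    then show "realizes N (\<lambda>\<mu> x. (state Y P S' \<mu> x)(d + d' := inner_n N (form (\<lambda>_. 0) 0 0 1 0) (state Y P S' \<mu> x) + 0 +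
        - 1 * max 0 (inner_n N (form (\<lambda>j. - \<beta> j) 0 0 1 (- \<gamma>)) (state Y P S' \<mu> x) + - a)))"
      using run S' by (simp add: runs_def)
  qed (use mf in \<open>auto simp: N_def\<close>)
qed

text \<open>The first alternative initialises register \<open>k\<close>; the second accumulates by
  \<open>max y p = y + max 0 (p - y)\<close>.\<close>

lemma runs_output:
  assumes k: "k < d'" and mf: "\<And>k. mf (Y k)" "mf P"
    and run: "runs (Y(k := P)) P \<or> runs (Y(k := \<lambda>z. max (Y k z) (P z))) P"
  shows "runs Y P"
  using run
proof
  assume run: "runs (Y(k := P)) P"
  \<comment> \<open>The first index 0 of \<open>form\<close> is a dummy with coefficient 0, a valid
    register because \<open>d'\<close> is positive.\<close>
  have "(\<lambda>\<mu> x. (state Y P S \<mu> x)(d + k := inner_n N (form (\<lambda>_. 0) 0 0 1 0) (state Y P S \<mu> x) + 0 +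
      0 * max 0 (inner_n N (\<lambda>_. 0) (state Y P S \<mu> x) + 0))) = state (Y(k := P)) P S" for S
    by (rule ext, rule ext, rule state_upd_Y[OF k]) (simp add: inner_state d'_pos)
  then show ?thesis unfolding runs_def
    by (intro allI impI realizes_update[where h = False and Y = Y and P = P and t = "d + k" and
        r = "form (\<lambda>_. 0) 0 0 1 0" and b = 0 and c = 0 and w = "\<lambda>_. 0" and \<tau> = 0])
      (use mf k run in \<open>auto simp: N_def runs_def\<close>)
next
  assume run: "runs (Y(k := \<lambda>z. max (Y k z) (P z))) P"
  have "(\<lambda>\<mu> x. (state Y P S \<mu> x)(d + k := inner_n N (form (\<lambda>_. 0) k 1 0 0) (state Y P S \<mu> x) + 0 +
      1 * max 0 (inner_n N (form (\<lambda>_. 0) k (- 1) 1 0) (state Y P S \<mu> x) + 0))) =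
      state (Y(k := \<lambda>z. max (Y k z) (P z))) P S" for S
    by (rule ext, rule ext, rule state_upd_Y[OF k]) (simp add: inner_state k)
  then show ?thesis unfolding runs_def
    by (intro allI impI realizes_update[where h = False and Y = Y and P = P and t = "d + k" and
        r = "form (\<lambda>_. 0) k 1 0 0" and b = 0 and c = 1 and w = "form (\<lambda>_. 0) k (- 1) 1 0" and \<tau> = 0])
      (use mf k run in \<open>auto simp: N_def runs_def\<close>)
qed

lemma mf_min: "mf f \<Longrightarrow> mf g \<Longrightarrow> mf (\<lambda>z. min (f z) (g z))"
  by (auto simp: mf_def intro!: borel_measurable_min)

lemma mf_max: "mf f \<Longrightarrow> mf g \<Longrightarrow> mf (\<lambda>z. max (f z) (g z))"
  by (auto simp: mf_def intro!: borel_measurable_max)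

lemma mf_mins: "g \<in> mins (features d) \<Longrightarrow> mf g"
  by (induction rule: mins.induct) (auto intro: mf_min simp: features_def mf_feature)

lemma mf_maxs: "h \<in> maxs (mins (features d)) \<Longrightarrow> mf h"
  by (induction rule: maxs.induct) (auto intro: mf_mins mf_max)

text \<open>The last argument of the minimum is peeled off by \<open>runs_min\<close>. The initial
  content \<open>P\<close> is arbitrary, since loading the first feature overwrites it.\<close>

lemma runs_mins:
  assumes "g \<in> mins (features d)" "\<And>k. mf (Y k)" "mf P" "runs Y g"
  shows "runs Y P"
  using assms
proof (induction arbitrary: P)
  case (base f)
  then show ?case by (rule runs_load)
next
  case (step g f)
  show ?case
    by (rule step.IH[OF step.prems(1,2) runs_min[OF step.hyps(2) step.prems(1) mf_mins[OF step.hyps(1)] step.prems(3)]])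
qed

text \<open>The continuation must hold for every \<open>P\<close>, because the partial-minimum
  register is left holding the last minimum evaluated.\<close>

lemma runs_maxs:
  assumes "h \<in> maxs (mins (features d))" "k < d'" "\<And>k. mf (Y k)" "mf P"
    "\<And>P. mf P \<Longrightarrow> runs (Y(k := h)) P"
  shows "runs Y P"
  using assms
proof (induction arbitrary: P)
  case (base g)
  then show ?case by (meson runs_mins runs_output mf_mins)
next
  case (step h g)
  have run: "runs (Y(k := h)) P" if "mf P" for P
  proof (rule runs_mins[OF step.hyps(2)])
    show *: "mf ((Y(k := h)) j)" for j using step mf_maxs by auto
    have eq: "(Y(k := h))(k := \<lambda>z. max ((Y(k := h)) k z) (g z)) = Y(k := \<lambda>z. max (h z) (g z))" by simp
    have g: "mf g" by (rule mf_mins[OF step.hyps(2)])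
    show "runs (Y(k := h)) g"
      by (rule runs_output[OF step.prems(1) * g disjI2]) (unfold eq, rule step.prems(4)[OF g])
  qed (rule that)
  show ?case by (rule step.IH[OF step.prems(1-3) run])
qed

lemma runs_final:
  assumes "\<And>k. k < d' \<Longrightarrow> Y k = R k" "\<And>k. mf (Y k)" "mf P"
  shows "runs Y P"
  unfolding runs_def
proof (intro allI impI)
  fix S assume "mf S"
  define G where "G = (\<lambda>\<mu> x i. if i < d' then Y i (\<mu>, x) else 0)"
  show "realizes N (state Y P S)"
  proof (rule realizes_block[where n' = d' and G' = G and h = False and A = "\<lambda>i. form (\<lambda>_. 0) i 1 0 0" and b = "\<lambda>_. 0" and
        c = "\<lambda>_. 0" and w = "\<lambda>_. 0" and \<tau> = 0])
    have mean: "add_mean False N m (state Y P S \<mu> x) = state Y P S \<mu> x" for m \<mu> x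
      by (auto simp: fun_eq_iff add_mean_def state_def N_def)
    show "relu_form N d' (\<lambda>i. form (\<lambda>_. 0) i 1 0 0) (\<lambda>_. 0) (\<lambda>_. 0) (\<lambda>_. 0) 0
        (add_mean False N (LINT y|\<mu>. state Y P S \<mu> y (N - 1)) (state Y P S \<mu> x)) = G \<mu> x" for \<mu> x
      unfolding mean by (auto simp: relu_form_def fun_eq_iff G_def inner_state)
    show "realizes d' G \<or> d' = d' \<and> (\<forall>\<mu> x i. \<mu> \<in> Prob \<Omega> \<longrightarrow> i < d' \<longrightarrow> G \<mu> x i = R i (\<mu>, x))"
      by (simp add: G_def assms(1))
  qed (use assms \<open>mf S\<close> d'_pos borel_measurable_state in \<open>auto simp: N_def\<close>)
qed

lemma realizes_maxs:
  assumes R: "\<And>k. R k \<in> maxs (mins (features d))"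
  shows "realizes d (\<lambda>\<mu> x. x)"
proof -
  \<comment> \<open>In \<open>Y n\<close> the first \<open>n\<close> outputs are finished. Building
    backwards, the induction starts with all \<open>d'\<close> of them and frees one register at a
    time.\<close>
  define Y where "Y n = (\<lambda>k z. if k < n then R k z else 0)" for n
  have zero: "mf (\<lambda>_. 0)" by (simp add: mf_def)
  have mfY: "mf (Y n k)" for n k
    using mf_maxs[OF R[of k]] by (auto simp: Y_def mf_def)
  have "runs (Y (d' - n)) P" if "n \<le> d'" "mf P" for n P
    using that
  proof (induction n arbitrary: P)
    case 0
    then show ?case using mfY by (intro runs_final) (auto simp: Y_def)
  next
    case (Suc n)
    have eq: "(Y (d' - Suc n))(d' - Suc n := R (d' - Suc n)) = Y (d' - n)"
      using Suc.prems by (auto simp: Y_def fun_eq_iff)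
    show ?case
      by (rule runs_maxs[OF R[of "d' - Suc n"], of "d' - Suc n"])
        (use Suc mfY in \<open>auto simp: eq\<close>)
  qed
  from this[of d' "\<lambda>_. 0"] have "realizes N (state (Y 0) (\<lambda>_. 0) (\<lambda>_. 0))"
    using zero by (auto simp: runs_def)
  from disjI1[OF this] show ?thesis
  \<comment> \<open>The initial block has width \<open>d\<close> and no head; it embeds the token
    next to registers that are all zero.\<close>
  proof (rule realizes_block[where h = False and A = "\<lambda>i j. if j = i then 1 else 0" and b = "\<lambda>_. 0" and
        c = "\<lambda>_. 0" and w = "\<lambda>_. 0" and \<tau> = 0])
    have "inner_n d (\<lambda>j. if j = i then 1 else 0) z = (if i < d then z i else 0)" for i z
      by (simp add: inner_n_def if_distrib[of "\<lambda>x. x * _"] cong: if_cong)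
    then show "relu_form d N (\<lambda>i j. if j = i then 1 else 0) (\<lambda>_. 0) (\<lambda>_. 0) (\<lambda>_. 0) 0
        (add_mean False d (LINT y|\<mu>. y (d - 1)) x) = state (Y 0) (\<lambda>_. 0) (\<lambda>_. 0) \<mu> x" for \<mu> x
      by (auto simp: relu_form_def fun_eq_iff add_mean_def state_def Y_def N_def)
  qed (auto simp: N_def)
qed

end

section \<open>From coordinatewise approximation to the transformer\<close>

lemma enorm_le_of_coordinates:
  assumes "\<And>i. i < n \<Longrightarrow> \<bar>v i\<bar> \<le> e / real n" "0 < n"
  shows "enorm n v \<le> e"
proof -
  have "enorm n v \<le> (\<Sum>i<n. \<bar>v i\<bar>)"
    using L2_set_le_sum_abs[of v "{..<n}"] by (simp add: enorm_def L2_set_def)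
  also have "\<dots> \<le> (\<Sum>i<n. e / real n)" by (rule sum_mono) (use assms in auto)
  finally show ?thesis using assms(2) by simp
qed

theorem theorem1:
  fixes d d' :: nat and \<Omega> :: "vec set" and \<Lambda> :: "vec measure \<Rightarrow> vec \<Rightarrow> vec"
  assumes "compact \<Omega>" and "\<Omega> \<subseteq> in_dim d"
    and "\<forall>\<mu>\<in>Prob \<Omega>. \<forall>x\<in>\<Omega>. \<Lambda> \<mu> x \<in> in_dim d'"
    and "continuous_map (prod_topology (weakstar \<Omega>) (top_of_set \<Omega>)) euclidean
           (\<lambda>(\<mu>, x). \<Lambda> \<mu> x)"
    and "\<epsilon> > (0::real)"
  shows "\<exists>blocks :: (attn \<times> mlp) list. blocks \<noteq> [] \<and>
     a_din (fst (hd blocks)) = d \<and>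
     (\<forall>l < length blocks. mlp_valid (snd (blocks ! l)) \<and>
        mlp_in (snd (blocks ! l)) = a_din (fst (blocks ! l)) \<and>
        mlp_out (snd (blocks ! l)) =
          (if Suc l < length blocks then a_din (fst (blocks ! Suc l)) else d') \<and>
        a_din (fst (blocks ! l)) \<le> d + 3 * d' \<and>
        a_dhead (fst (blocks ! l)) = 1 \<and> a_k (fst (blocks ! l)) = 1 \<and>
        a_H (fst (blocks ! l)) \<le> d') \<and>
     (\<forall>\<mu>\<in>Prob \<Omega>. \<forall>x\<in>\<Omega>.
        enorm d' (\<lambda>i. transformer blocks \<mu> x i - \<Lambda> \<mu> x i) \<le> \<epsilon>)"
proof (cases "d' = 0")
  case True
  \<comment> \<open>Without output coordinates the norm is an empty sum, and a headless block
    respects the bound of zero heads.\<close>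
  obtain F where "mlp_valid F" "mlp_in F = d" "mlp_out F = 0"
    using relu_form_mlp by blast
  then show ?thesis using True \<open>\<epsilon> > 0\<close>
    by (intro exI[of _ "[(mean_attn False d, F)]"]) (auto simp: mean_attn_def a_H_def enorm_def)
next
  case False
  have "\<exists>h\<in>maxs (mins (features d)). \<forall>z\<in>Prob \<Omega> \<times> \<Omega>. \<bar>h z - (case z of (\<mu>, x) \<Rightarrow> \<Lambda> \<mu> x k)\<bar> < \<epsilon> / real d'" for k
  proof (rule features_approximate[OF assms(1,2)])
    have "continuous_map euclidean euclideanreal (\<lambda>y::vec. y k)"
      using continuous_on_coord[of UNIV k] by simp
    from continuous_map_compose[OF assms(4) this]
    show "continuous_map (prod_topology (weakstar \<Omega>) (top_of_set \<Omega>)) euclideanreal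
        (\<lambda>z. case z of (\<mu>, x) \<Rightarrow> \<Lambda> \<mu> x k)"
      by (simp add: comp_def case_prod_unfold)
    show "\<epsilon> / real d' > 0" using False assms(5) by simp
  qed
  then have "\<forall>k. \<exists>h. h \<in> maxs (mins (features d)) \<and>
      (\<forall>\<mu>\<in>Prob \<Omega>. \<forall>x\<in>\<Omega>. \<bar>h (\<mu>, x) - \<Lambda> \<mu> x k\<bar> < \<epsilon> / real d')"
    unfolding Bex_def by simp
  then obtain R where R: "\<And>k. R k \<in> maxs (mins (features d))"
    "\<And>k \<mu> x. \<mu> \<in> Prob \<Omega> \<Longrightarrow> x \<in> \<Omega> \<Longrightarrow> \<bar>R k (\<mu>, x) - \<Lambda> \<mu> x k\<bar> < \<epsilon> / real d'"
    by (metis (no_types, lifting))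
  interpret register_machine d d' \<Omega> R by standard (use False in simp)
  obtain bs where bs: "chain (d + 3 * d') d' d d' bs"
    and ne: "bs \<noteq> []" and bs_eq:
    "\<And>\<mu> x i. \<mu> \<in> Prob \<Omega> \<Longrightarrow> i < d' \<Longrightarrow> transformer bs (distr \<mu> borel (\<lambda>x. x)) x i = R i (\<mu>, x)"
    using realizes_maxs[OF R(1)] unfolding realizes_def by blast
  \<comment> \<open>The program starts from the identity, and pushing \<mu> forward along it returns
    \<mu> because its measurable sets are the Borel sets.\<close>
  have "transformer bs \<mu> x i = R i (\<mu>, x)" if "\<mu> \<in> Prob \<Omega>" "i < d'" for \<mu> x i
    using bs_eq[OF that] distr_id2[of borel \<mu>] Prob_D(2)[OF that(1)] by simp
  then have "enorm d' (\<lambda>i. transformer bs \<mu> x i - \<Lambda> \<mu> x i) \<le> \<epsilon>" if "\<mu> \<in> Prob \<Omega>" "x \<in> \<Omega>" for \<mu> x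
    using that R(2) False by (intro enorm_le_of_coordinates) (auto intro: less_imp_le)
  moreover have "a_din (fst (hd bs)) = d"
    using bs ne by (cases bs) auto
  ultimately show ?thesis using chain_nth[OF bs] ne by (intro exI[of _ bs]) blast
qed

end
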